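(* For every fixed integer $r\ge3$, real number $s>\frac{r}{r-1}$ and $\varepsilon>0$, put $\alpha_{r,s}=\frac{s}{(r-1)s-r}$. There is a constant $T=T(r,s,\varepsilon)$ such that, for all sufficiently large $n$, every $n$-vertex $r$-graph of average degree at least $n^{1/\alpha_{r,s}+\varepsilon}$ contains a nonempty subhypergraph of average degree at least $s$ on at most $T$ vertices. Moreover, for fixed $r$, $s$ and $\varepsilon$, such a subhypergraph can be found (by an algorithm given the $r$-graph as input) in time $n^{O_{r,s,\varepsilon}(1)}$.
   Context: An $r$-graph ($r$-uniform hypergraph) is a pair $H=(V(H),E(H))$ with $V(H)$ a finite set and $E(H)\subseteq\binom{V(H)}{r}$; $e(H)=|E(H)|$. An $r$-graph $F$ is a subhypergraph of $H$ if $V(F)\subseteq V(H)$ and $E(F)\subseteq E(H)$. The average degree of an $r$-graph $H$ with nonempty vertex set is $\overline d(H)=r\,e(H)/|V(H)|$. *)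

theory Defs
  imports Complex_Main "HOL-Library.Ramsey"
begin

type_synonym 'a hypergraph = "'a set \<times> 'a set set"

abbreviation verts :: "'a hypergraph \<Rightarrow> 'a set" where
  "verts H \<equiv> fst H"

abbreviation edges :: "'a hypergraph \<Rightarrow> 'a set set" where
  "edges H \<equiv> snd H"

definition r_graph :: "nat \<Rightarrow> 'a hypergraph \<Rightarrow> bool" where
  "r_graph r H \<longleftrightarrow> finite (verts H) \<and> edges H \<subseteq> nsets (verts H) r"

definition subhypergraph :: "'a hypergraph \<Rightarrow> 'a hypergraph \<Rightarrow> bool" where
  "subhypergraph F H \<longleftrightarrow> verts F \<subseteq> verts H \<and> edges F \<subseteq> edges H"

definition avg_degree :: "nat \<Rightarrow> 'a hypergraph \<Rightarrow> real" where
  "avg_degree r H = real r * real (card (edges H)) / real (card (verts H))"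

definition small_dense_sub ::
    "nat \<Rightarrow> real \<Rightarrow> nat \<Rightarrow> 'a hypergraph \<Rightarrow> 'a hypergraph \<Rightarrow> bool" where
  "small_dense_sub r s T H F \<longleftrightarrow>
     r_graph r F \<and> subhypergraph F H \<and> verts F \<noteq> {} \<and>
     avg_degree r F \<ge> s \<and> card (verts F) \<le> T"

definition alpha :: "nat \<Rightarrow> real \<Rightarrow> real" where
  "alpha r s = s / ((real r - 1) * s - real r)"

text \<open>
  Algorithms are structured programs for a random access machine with registers
  and a separate, indirectly addressed memory, all cells holding natural numbers.
  Every elementary operation and every test costs one time unit.  The only
  arithmetic is addition and truncated subtraction, so a single step lengthens
  the binary representation of the largest number in the machine by at most one
  bit (up to the constants of the program).  Hence unit cost time is polynomially
  related to Turing machine time, which would fail if multiplication were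
  an elementary operation.
\<close>

datatype program =
    Skip
  | Const nat nat
  | Add nat nat nat
  | Sub nat nat nat
  | Load nat nat
  | Store nat nat
  | Seq program program
  | IfPos nat program program
  | WhilePos nat program

text \<open>A state consists of the register contents and the memory contents; the third
  argument of \<open>exec\<close> is the exact running time.\<close>

type_synonym state = "(nat \<Rightarrow> nat) \<times> (nat \<Rightarrow> nat)"

inductive exec :: "program \<Rightarrow> state \<Rightarrow> nat \<Rightarrow> state \<Rightarrow> bool" where
  Skip: "exec Skip \<sigma> 1 \<sigma>"
| Const: "exec (Const i k) (R, M) 1 (R(i := k), M)"
| Add: "exec (Add i j k) (R, M) 1 (R(i := R j + R k), M)"
| Sub: "exec (Sub i j k) (R, M) 1 (R(i := R j - R k), M)"
| Load: "exec (Load i j) (R, M) 1 (R(i := M (R j)), M)"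
| Store: "exec (Store i j) (R, M) 1 (R, M(R i := R j))"
| Seq: "exec p \<sigma> t \<rho> \<Longrightarrow> exec q \<rho> u \<tau> \<Longrightarrow> exec (Seq p q) \<sigma> (t + u) \<tau>"
| IfTrue: "fst \<sigma> i > 0 \<Longrightarrow> exec p \<sigma> t \<tau> \<Longrightarrow> exec (IfPos i p q) \<sigma> (1 + t) \<tau>"
| IfFalse: "fst \<sigma> i = 0 \<Longrightarrow> exec q \<sigma> t \<tau> \<Longrightarrow> exec (IfPos i p q) \<sigma> (1 + t) \<tau>"
| WhileTrue: "fst \<sigma> i > 0 \<Longrightarrow> exec p \<sigma> t \<rho> \<Longrightarrow> exec (WhilePos i p) \<rho> u \<tau>
    \<Longrightarrow> exec (WhilePos i p) \<sigma> (1 + t + u) \<tau>"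
| WhileFalse: "fst \<sigma> i = 0 \<Longrightarrow> exec (WhilePos i p) \<sigma> 1 \<sigma>"

text \<open>A list of numbers is passed to and returned by a program in memory from address
  0 on, with its length in register 0; all other cells are initially 0.\<close>

definition input_state :: "nat list \<Rightarrow> state" where
  "input_state xs = ((\<lambda>_. 0)(0 := length xs), (\<lambda>a. if a < length xs then xs ! a else 0))"

definition output_of :: "state \<Rightarrow> nat list" where
  "output_of \<sigma> = map (snd \<sigma>) [0..<fst \<sigma> 0]"

definition runs_in :: "program \<Rightarrow> nat list \<Rightarrow> nat \<Rightarrow> nat list \<Rightarrow> bool" where
  "runs_in p xs t ys \<longleftrightarrow> (\<exists>\<tau>. exec p (input_state xs) t \<tau> \<and> output_of \<tau> = ys)"

text \<open>
  A hypergraph on natural numbers is presented by the number of its vertices, the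
  vertices, the number of its edges, and the edges as blocks of vertices.  Every
  vertex and every edge is listed exactly once, but the order of the vertices, of the
  edges, and of the vertices within an edge is arbitrary, so a hypergraph
  has many presentations.  For \<open>r\<close>-graphs the blocks all have length \<open>r\<close>.
\<close>

definition presents :: "nat list \<Rightarrow> nat hypergraph \<Rightarrow> bool" where
  "presents xs H \<longleftrightarrow>
     (\<exists>vs es. distinct vs \<and> set vs = verts H \<and>
              (\<forall>e\<in>set es. distinct e) \<and> distinct (map set es) \<and> set (map set es) = edges H \<and>
              xs = length vs # vs @ length es # concat es)"

end

theory Submission
  imports Defs "HOL-Real_Asymp.Real_Asymp"
begin

text \<open>
  Choose a rational \<open>a / q\<close> slightly below \<open>r / s\<close>.  Following the balanced rooted trees of
  Bukh and Conlon, consider caterpillar-like hypertrees with \<open>q\<close> edges, \<open>a\<close> free vertices and all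
  other vertices prescribed (roots), in which every set \<open>S\<close> of free vertices meets at least
  \<open>q |S| / a\<close> edges.  Such a balanced hypertree comes from the jumps of \<open>\<lceil>k a / q\<rceil>\<close>.
  In a subhypergraph of large minimum degree there are so many homomorphic copies (with pairwise distinct
  edges) that, by pigeonhole, arbitrarily many share the same roots.  Adding these copies one by one to a
  vertex set \<open>U\<close>, each gains at least \<open>q / a\<close> edges per new vertex, so the number of edges in \<open>U\<close> is at least
  \<open>(q / a) (|U| - O(1))\<close>, and \<open>q / a > s / r\<close>.  Copies need not be injective: identified vertices only
  help, as long as the edges stay distinct.

  There is so much room that one may prescribe both the number \<open>T\<close> of vertices and the number \<open>k\<close> of
  edges.  The algorithm is therefore a nest of \<open>T + k\<close> loops over vertices and pointers to input
  edges.  It never stops early: each success overwrites the output, which lies below the edge list.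
\<close>

section \<open>Walks with prescribed roots\<close>

text \<open>Among the nonempty sets inducing at least \<open>D\<close> edges per vertex, one of
  least size works: deleting a vertex of degree below \<open>D\<close> would leave a smaller such
  set.\<close>

lemma ex_min_degree_subset:
  fixes D :: real
  assumes "finite V" "V \<noteq> {}" "E \<subseteq> nsets V r" "r \<ge> 2" "D > 0" "D * card V \<le> card E"
  obtains W where "W \<subseteq> V" "W \<noteq> {}" "\<And>v. v \<in> W \<Longrightarrow> D \<le> card {e \<in> E. e \<subseteq> W \<and> v \<in> e}"
proof -
  have finE: "finite E" using assms(1,3) by (meson finite_imp_finite_nsets finite_subset)
  define P where "P W \<longleftrightarrow> W \<subseteq> V \<and> W \<noteq> {} \<and> D * card W \<le> card {e \<in> E. e \<subseteq> W}" for W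
  have "{e \<in> E. e \<subseteq> V} = E" using assms(3) by (auto simp: nsets_def)
  then have "P V" using assms by (simp add: P_def)
  then obtain W where W: "P W" and min: "\<And>W'. P W' \<Longrightarrow> card W \<le> card W'"
    using ex_has_least_nat[of P V card] by blast
  have finW: "finite W" using W assms(1) by (auto simp: P_def intro: finite_subset)
  show thesis
  proof
    show "W \<subseteq> V" "W \<noteq> {}" using W by (auto simp: P_def)
    fix v assume v: "v \<in> W"
    have split: "{e \<in> E. e \<subseteq> W} = {e \<in> E. e \<subseteq> W - {v}} \<union> {e \<in> E. e \<subseteq> W \<and> v \<in> e}" by auto
    have card_split: "card {e \<in> E. e \<subseteq> W} = card {e \<in> E. e \<subseteq> W - {v}} + card {e \<in> E. e \<subseteq> W \<and> v \<in> e}"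
      unfolding split by (rule card_Un_disjoint) (use finE in auto)
    have "\<not> P (W - {v})" using min[of "W - {v}"] v finW
      by (metis card_Diff1_less not_le)
    \<comment> \<open>A single vertex spans no edge because \<open>r \<ge> 2\<close>; hence the
      failure of \<open>P\<close> for \<open>W - {v}\<close> is a failure of density.\<close>
    moreover have "W - {v} \<noteq> {}"
    proof
      assume "W - {v} = {}"
      then have "W = {v}" using v by auto
      then have "{e \<in> E. e \<subseteq> W} = {}"
        using assms(3,4) by (auto simp: nsets_def subset_singleton_iff)
      then have "D * card W \<le> 0" using W unfolding P_def by (metis card.empty of_nat_0)
      then show False using \<open>W = {v}\<close> assms(5) by simp
    qed
    ultimately have "card {e \<in> E. e \<subseteq> W - {v}} < D * card (W - {v})"
      using W by (auto simp: P_def)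
    also have "\<dots> = D * card W - D"
      using v finW card_Suc_Diff1[OF finW v, symmetric] by (simp add: algebra_simps)
    finally show "D \<le> card {e \<in> E. e \<subseteq> W \<and> v \<in> e}"
      using W card_split by (simp add: P_def)
  qed
qed

section \<open>The rounded sequence of jumps\<close>

text \<open>For \<open>q > 0\<close> this is the ceiling of \<open>k * a / q\<close>, the number of
  free vertices in the first \<open>k\<close> blocks. Rounding up keeps
  \<open>q * profile a q k - k * a\<close> between 0 and \<open>q - 1\<close>.\<close>

definition profile :: "nat \<Rightarrow> nat \<Rightarrow> nat \<Rightarrow> nat" where
  "profile a q k = (k * a + q - 1) div q"

definition step :: "nat \<Rightarrow> nat \<Rightarrow> nat \<Rightarrow> nat" where
  "step a q k = profile a q (Suc k) - profile a q k"

lemma profile_bounds: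
  assumes "q > 0"
  shows "k * a \<le> q * profile a q k" "q * profile a q k < k * a + q"
proof -
  have "q * profile a q k + (k * a + q - 1) mod q = k * a + q - 1"
    unfolding profile_def by (rule mult_div_mod_eq)
  moreover have "(k * a + q - 1) mod q < q" using assms by simp
  ultimately show "k * a \<le> q * profile a q k" "q * profile a q k < k * a + q"
    using assms by linarith+
qed

lemma profile_mono: "profile a q k \<le> profile a q (Suc k)"
  unfolding profile_def by (intro div_le_mono) auto

lemma profile_Suc: "profile a q (Suc k) = profile a q k + step a q k"
  using profile_mono by (simp add: step_def)

lemma profile_0: "profile a q 0 = 0"
  by (cases q) (auto simp: profile_def)

lemma profile_self: "q > 0 \<Longrightarrow> profile a q q = a"
  using profile_bounds[where q = q and k = q and a = a] mult_less_cancel1[of q "profile a q q" "a + 1"]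
  by (auto simp: algebra_simps)

text \<open>Consecutive rounded multiples of \<open>a / q \<le> b\<close> differ by at most
  \<open>b\<close>, so a block of length \<open>b\<close> has room for its free vertices.\<close>

lemma step_le:
  assumes "q > 0" "a \<le> q * b"
  shows "step a q k \<le> b"
proof -
  have "q * profile a q (Suc k) < q * profile a q k + q * b + q"
    using profile_bounds(1)[OF assms(1), where k = k and a = a]
      profile_bounds(2)[OF assms(1), where k = "Suc k" and a = a] assms(2) by simp
  then have "q * profile a q (Suc k) < q * (profile a q k + b + 1)" by (simp add: algebra_simps)
  then have "profile a q (Suc k) < profile a q k + b + 1" using mult_less_cancel1 by blast
  then show ?thesis by (simp add: step_def)
qed

section \<open>Walks and their number\<close>

text \<open>A walk is stored with its latest edge first.  Each edge consists of the current tip and a block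
  \<open>w\<close> of further vertices; the first \<open>g k\<close> vertices of the \<open>k\<close>-th block are free, the others are
  roots, and the tip moves to the first free vertex, if there is one.\<close>

fun tip :: "(nat \<Rightarrow> nat) \<Rightarrow> 'a \<Rightarrow> 'a list list \<Rightarrow> 'a" where
  "tip g v [] = v"
| "tip g v (w # ws) = (if g (length ws) = 0 then tip g v ws else hd w)"

fun trail :: "(nat \<Rightarrow> nat) \<Rightarrow> 'a \<Rightarrow> 'a list list \<Rightarrow> 'a set list" where
  "trail g v [] = []"
| "trail g v (w # ws) = insert (tip g v ws) (set w) # trail g v ws"

fun roots :: "(nat \<Rightarrow> nat) \<Rightarrow> 'a list list \<Rightarrow> 'a list" where
  "roots g [] = []"
| "roots g (w # ws) = drop (g (length ws)) w @ roots g ws"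

text \<open>Only the edges have to be distinct; vertices may recur. If all edges of \<open>E\<close>
  have \<open>Suc b\<close> vertices, the entries of a block are automatically distinct and
  different from the tip to which the block is attached.\<close>

definition walks :: "(nat \<Rightarrow> nat) \<Rightarrow> 'a set set \<Rightarrow> nat \<Rightarrow> 'a \<Rightarrow> nat \<Rightarrow> 'a list list set" where
  "walks g E b v m = {ws. length ws = m \<and> (\<forall>w\<in>set ws. length w = b) \<and>
     distinct (trail g v ws) \<and> set (trail g v ws) \<subseteq> E}"

lemma length_trail [simp]: "length (trail g v ws) = length ws"
  by (induction ws) auto


lemma set_trail_subset: "\<Union>(set (trail g v ws)) \<subseteq> insert v (\<Union>(set ` set ws))" if "[] \<notin> set ws"
proof -
  have tip: "tip g v ws \<in> insert v (\<Union>(set ` set ws))" if "[] \<notin> set ws" for ws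
    using that by (induction ws) auto
  show ?thesis using that
  proof (induction ws)
    case (Cons w ws)
    then show ?case using tip[of ws] by auto
  qed simp
qed

lemma walks_verts:
  assumes "ws \<in> walks g E b v m" "\<Union>E \<subseteq> W" "v \<in> W" "b > 0"
  shows "\<Union>(set ` set ws) \<subseteq> W" "tip g v ws \<in> W"
proof -
  have "set (trail g v ws) \<subseteq> E" "\<forall>w\<in>set ws. length w = b"
    using assms(1) by (auto simp: walks_def)
  then have "\<Union>(set ` set ws) \<subseteq> W \<and> tip g v ws \<in> W"
    using assms(2-4)
  proof (induction ws)
    case (Cons w ws)
    then have "w \<noteq> []" "set w \<subseteq> W" by auto
    then show ?case using Cons by (auto simp: in_mono)
  qed simp
  then show "\<Union>(set ` set ws) \<subseteq> W" "tip g v ws \<in> W" by auto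
qed

lemma finite_walks:
  assumes "finite W" "\<Union>E \<subseteq> W" "v \<in> W" "b > 0"
  shows "finite (walks g E b v m)"
proof (rule finite_subset)
  show "walks g E b v m \<subseteq> {ws. set ws \<subseteq> {w. set w \<subseteq> W \<and> length w = b} \<and> length ws = m}"
    using walks_verts(1)[OF _ assms(2-4)] by (fastforce simp: walks_def)
  show "finite {ws. set ws \<subseteq> {w. set w \<subseteq> W \<and> length w = b} \<and> length ws = m}"
    by (intro finite_lists_length_eq assms)
qed

text \<open>A walk can be continued by any edge at its tip that is not yet in the trail. At most
  \<open>k\<close> of the at least \<open>D\<close> edges are excluded, so each of the
  \<open>m\<close> steps multiplies the number of walks by at least \<open>D - k\<close>.\<close>

lemma card_walks_ge:
  assumes "finite W" "E \<subseteq> nsets W (Suc b)" "b > 0" "v \<in> W" "m \<le> k"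
    and deg: "\<And>v. v \<in> W \<Longrightarrow> D \<le> card {e \<in> E. v \<in> e}"
  shows "(D - k) ^ m \<le> card (walks g E b v m)"
  using \<open>m \<le> k\<close>
proof (induction m)
  case 0
  have "walks g E b v 0 = {[]}" by (auto simp: walks_def)
  then show ?case by simp
next
  case (Suc m)
  have EW: "\<Union>E \<subseteq> W" using assms(2) by (auto simp: nsets_def)
  note fin = finite_walks[OF \<open>finite W\<close> EW \<open>v \<in> W\<close> \<open>b > 0\<close>]
  have finE: "finite E" using assms(1,2) by (meson finite_imp_finite_nsets finite_subset)
  define ext where "ext ws = {w. w # ws \<in> walks g E b v (Suc m)}" for ws
  have ext: "D - k \<le> card (ext ws)" "finite (ext ws)" if ws: "ws \<in> walks g E b v m" for ws
  proof -
    let ?t = "tip g v ws"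
    let ?N = "{e \<in> E. ?t \<in> e} - set (trail g v ws)"
    have "\<exists>w. set w = e - {?t} \<and> length w = b" if "e \<in> ?N" for e
    proof -
      have "finite e" "card e = Suc b" "?t \<in> e" using that assms(2) by (auto simp: nsets_def)
      then have "card (e - {?t}) = b" "finite (e - {?t})" by auto
      then show ?thesis using finite_distinct_list[of "e - {?t}"] distinct_card by fastforce
    qed
    then have "\<forall>e\<in>?N. \<exists>w. set w = e - {?t} \<and> length w = b" by blast
    then obtain f where "\<forall>e\<in>?N. set (f e) = e - {?t} \<and> length (f e) = b"
      by (rule bchoice[elim_format]) blast
    then have f: "set (f e) = e - {?t}" "length (f e) = b" if "e \<in> ?N" for e
      using that by blast+
    have "inj_on f ?N"
    proof (rule inj_onI)
      fix e e' assume *: "e \<in> ?N" "e' \<in> ?N" "f e = f e'"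
      then have "e - {?t} = e' - {?t}" using f(1)[OF *(1)] f(1)[OF *(2)] by simp
      then show "e = e'" using * by blast
    qed
    moreover have "f ` ?N \<subseteq> ext ws"
    proof (rule image_subsetI)
      fix e assume e: "e \<in> ?N"
      then have "insert ?t (set (f e)) = e" using f(1) by auto
      then show "f e \<in> ext ws" using ws e f(2)[OF e] by (auto simp: ext_def walks_def)
    qed
    moreover show fin_ext: "finite (ext ws)"
      unfolding ext_def
    proof (rule finite_subset)
      show "{w. w # ws \<in> walks g E b v (Suc m)} \<subseteq> hd ` walks g E b v (Suc m)"
        by (auto intro: image_eqI[of _ hd "_ # ws"])
    qed (use fin in simp)
    ultimately have "card ?N \<le> card (ext ws)" by (rule card_inj_on_le)
    moreover have "card {e \<in> E. ?t \<in> e} - card (set (trail g v ws)) \<le> card ?N"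
      by (rule diff_card_le_card_Diff) simp
    moreover have "card (set (trail g v ws)) \<le> k"
      using ws Suc.prems card_length[of "trail g v ws"] by (simp add: walks_def)
    moreover have "D \<le> card {e \<in> E. ?t \<in> e}"
      by (intro deg walks_verts(2)[OF ws EW]) fact+
    ultimately show "D - k \<le> card (ext ws)" by linarith
  qed
  have "(D - k) ^ Suc m \<le> card (walks g E b v m) * (D - k)"
    using Suc by (simp add: mult.commute mult_le_mono1)
  also have "\<dots> \<le> (\<Sum>ws\<in>walks g E b v m. card (ext ws))"
    using sum_bounded_below[of "walks g E b v m" "D - k" "\<lambda>ws. card (ext ws)"] ext(1) by simp
  also have "\<dots> = card (SIGMA ws:walks g E b v m. ext ws)"
    using ext(2) fin by (simp add: card_SigmaI)
  also have "\<dots> = card ((\<lambda>(ws, w). w # ws) ` (SIGMA ws:walks g E b v m. ext ws))"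
    by (subst card_image) (auto simp: inj_on_def)
  also have "\<dots> \<le> card (walks g E b v (Suc m))"
    by (intro card_mono fin) (auto simp: ext_def)
  finally show ?case .
qed

text \<open>Each block splits into its free vertices and its roots, and the jumps telescope to
  \<open>profile\<close>. A full walk, with \<open>q\<close> blocks, therefore has
  \<open>q * b - a\<close> roots.\<close>

lemma length_roots:
  assumes "\<forall>w\<in>set ws. length w = b" "\<And>k. step a q k \<le> b"
  shows "length (roots (step a q) ws) + profile a q (length ws) = length ws * b"
  using assms(1)
proof (induction ws)
  case (Cons w ws)
  then show ?case using assms(2)[of "length ws"] by (auto simp: profile_Suc)
qed (simp add: profile_0)

section \<open>Edges gained per new vertex\<close>

text \<open>The tip of an incomplete walk may be a new vertex whose later edges have not been
  counted yet; the last summand is the credit for these.\<close>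

lemma new_vertices_bound:
  assumes "q > 0" "v \<in> U" "\<forall>w\<in>set ws. w \<noteq> []" "set (roots (step a q) ws) \<subseteq> U"
  shows "q * card (\<Union>(set ` set ws) - U) \<le>
     a * length (filter (\<lambda>e. \<not> e \<subseteq> U) (trail (step a q) v ws)) +
     (if tip (step a q) v ws \<in> U then 0 else q * profile a q (length ws) - length ws * a)"
  using assms(3,4)
proof (induction ws)
  case (Cons w ws)
  define k g where "k = length ws" and "g = step a q k"
  define X where "X = card (\<Union>(set ` set ws) - U)"
  define X' where "X' = card (\<Union>(set ` set (w # ws)) - U)"
  define x where "x = card (set w - U)"
  define L where "L = length (filter (\<lambda>e. \<not> e \<subseteq> U) (trail (step a q) v ws))"
  define c where "c = q * profile a q k - k * a"
  define c' where "c' = q * profile a q (Suc k) - Suc k * a"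
  let ?t = "tip (step a q) v ws"
  let ?t' = "tip (step a q) v (w # ws)"
  have IH: "q * X \<le> a * L + (if ?t \<in> U then 0 else c)"
    unfolding X_def L_def c_def k_def by (rule Cons.IH) (use Cons.prems in auto)
  have X': "X' \<le> X + x"
  proof -
    have "\<Union>(set ` set (w # ws)) - U = (\<Union>(set ` set ws) - U) \<union> (set w - U)" by auto
    then show ?thesis unfolding X'_def X_def x_def by (metis card_Un_le)
  qed
  \<comment> \<open>The balance of one step: the price \<open>a\<close> of an edge turns the credit
    \<open>c\<close> into \<open>c'\<close> when \<open>g\<close> new vertices are charged
    \<open>q\<close> each.\<close>
  have cc: "q * g + c = a + c'"
    using profile_bounds(1)[OF assms(1), where k = k and a = a] profile_bounds(1)[OF assms(1), where k = "Suc k" and a = a]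
    by (simp add: c_def c'_def profile_Suc g_def algebra_simps)
  have c'_less: "c' < q"
    using profile_bounds[OF assms(1), where k = "Suc k" and a = a] unfolding c'_def by linarith
  have drop: "set (drop g w) \<subseteq> U" using Cons.prems by (simp add: g_def k_def)
  have new: "set w - U \<subseteq> set (take g w) - U"
    using drop set_append[of "take g w" "drop g w"] by auto
  have x_le: "x \<le> g"
  proof -
    have "x \<le> card (set (take g w))"
      unfolding x_def using new by (meson Diff_subset List.finite_set card_mono order_trans)
    also have "\<dots> \<le> g" using card_length[of "take g w"] by simp
    finally show ?thesis .
  qed
  \<comment> \<open>If the next tip is already in \<open>U\<close>, one of the \<open>g\<close> free
    places brings nothing new. The saved \<open>q\<close> exceeds \<open>c'\<close>, the credit that
    is no longer available.\<close>
  have x_le': "Suc x \<le> g" if "g > 0" "hd w \<in> U"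
  proof -
    obtain y ys where w: "w = y # ys" using Cons.prems by (cases w) auto
    have "set w - U \<subseteq> set (take (g - 1) ys)"
      using new that by (auto simp: w take_Cons')
    then have "x \<le> card (set (take (g - 1) ys))"
      unfolding x_def by (intro card_mono) auto
    also have "\<dots> \<le> g - 1" using card_length[of "take (g - 1) ys"] by simp
    finally show ?thesis using that by simp
  qed
  have qx: "q * x \<le> q * g" using x_le by simp
  have qx': "q * x + q \<le> q * g" if "g > 0" "hd w \<in> U"
    using mult_le_mono2[OF x_le'[OF that], of q] by simp
  have qX': "q * X' \<le> q * X + q * x" using X' by (metis add_mult_distrib2 mult_le_mono2)
  have t': "?t' = (if g = 0 then ?t else hd w)" by (simp add: g_def k_def)
  \<comment> \<open>What the new edge contributes: it counts unless its tip and its whole block lie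
    in \<open>U\<close>.\<close>
  define d where "d = (if insert ?t (set w) \<subseteq> U then 0 else a)"
  have "q * X' \<le> a * L + d + (if ?t' \<in> U then 0 else c')"
  proof -
    \<comment> \<open>If tip and block are both old, there is nothing to pay. If the next tip is
      old, one vertex is saved. In the remaining cases the edge pays \<open>a\<close>, and the
      identity between \<open>c\<close> and \<open>c'\<close> balances the account.\<close>
    consider "?t \<notin> U" "g = 0" | "?t \<notin> U" "g > 0" "hd w \<in> U" | "?t \<notin> U" "g > 0" "hd w \<notin> U"
      | "?t \<in> U" "x = 0" | "?t \<in> U" "x > 0" "g > 0" "hd w \<in> U" | "?t \<in> U" "x > 0" "g > 0" "hd w \<notin> U"
      using x_le by fastforce
    then show ?thesis
    proof cases
      case 1
      then have "d = a" "?t' \<notin> U" using t' by (auto simp: d_def)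
      moreover have "q * x = 0" "q * g = 0" "q * X \<le> a * L + c" using IH 1 x_le by simp_all
      then have "q * X' \<le> a * L + a + c'" using qX' cc by linarith
      ultimately show ?thesis by simp
    next
      case 2
      then have "d = a" "?t' \<in> U" using t' by (auto simp: d_def)
      moreover have "q * X \<le> a * L + c" using IH 2 by simp
      then have "q * X' \<le> a * L + a" using qX' qx'[OF 2(2,3)] cc c'_less by linarith
      ultimately show ?thesis by simp
    next
      case 3
      then have "d = a" "?t' \<notin> U" using t' by (auto simp: d_def)
      moreover have "q * X \<le> a * L + c" using IH 3 by simp
      then have "q * X' \<le> a * L + a + c'" using qX' qx cc by linarith
      ultimately show ?thesis by simp
    next
      case 4
      then have "q * x = 0" "q * X \<le> a * L" using IH by simp_all
      then have "q * X' \<le> a * L" using qX' by linarith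
      then show ?thesis by simp
    next
      case 5
      then have "d = a" "?t' \<in> U" using t' by (auto simp: d_def x_def card_gt_0_iff)
      moreover have "q * X \<le> a * L + 0" using IH 5 by simp
      then have "q * X' \<le> a * L + a" using qX' qx'[OF 5(3,4)] cc c'_less by linarith
      ultimately show ?thesis by simp
    next
      case 6
      then have "d = a" "?t' \<notin> U" using t' by (auto simp: d_def x_def card_gt_0_iff)
      moreover have "q * X \<le> a * L + 0" using IH 6 by simp
      then have "q * X' \<le> a * L + a + c'" using qX' qx cc by linarith
      ultimately show ?thesis by simp
    qed
  qed
  moreover have "a * length (filter (\<lambda>e. \<not> e \<subseteq> U) (trail (step a q) v (w # ws))) = a * L + d"
    by (simp add: L_def d_def)
  ultimately show ?case unfolding X'_def c'_def k_def by (simp only: length_Cons)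
qed simp

text \<open>Such a walk amounts to \<open>b * m\<close> vertices of \<open>U\<close>, cut into
  blocks. A larger family must contain a walk that leaves \<open>U\<close>.\<close>

lemma card_walks_inside:
  assumes "finite U"
  shows "card {ws \<in> walks g E b v m. \<Union>(set ` set ws) \<subseteq> U} \<le> card U ^ (b * m)"
    and "finite {ws \<in> walks g E b v m. \<Union>(set ` set ws) \<subseteq> U}"
proof -
  let ?B = "{w. set w \<subseteq> U \<and> length w = b}"
  let ?A = "{ws. set ws \<subseteq> ?B \<and> length ws = m}"
  have sub: "{ws \<in> walks g E b v m. \<Union>(set ` set ws) \<subseteq> U} \<subseteq> ?A"
    by (auto simp: walks_def)
  have fin: "finite ?B" "finite ?A" by (intro finite_lists_length_eq assms)+
  have "card ?A = card U ^ (b * m)"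
    using card_lists_length_eq[OF fin(1)] card_lists_length_eq[OF assms] by (simp add: power_mult)
  then show "card {ws \<in> walks g E b v m. \<Union>(set ` set ws) \<subseteq> U} \<le> card U ^ (b * m)"
    using card_mono[OF fin(2) sub] by simp
  show "finite {ws \<in> walks g E b v m. \<Union>(set ` set ws) \<subseteq> U}" using sub fin(2) by (rule finite_subset)
qed

text \<open>After \<open>q\<close> edges the credit is \<open>q * profile a q q - q * a = 0\<close>,
  so the bound on new vertices has no extra term. Since the trail is distinct, the edges it counts
  are different new edges inside \<open>U'\<close>.\<close>

lemma extend_by_walk:
  assumes "q > 0" "b > 0" "finite E" "finite U" "v \<in> U" "ws \<in> walks (step a q) E b v q"
    and "set (roots (step a q) ws) \<subseteq> U"
  defines "U' \<equiv> U \<union> \<Union>(set ` set ws)"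
  shows "q * (card U' - card U) \<le> a * (card {e \<in> E. e \<subseteq> U'} - card {e \<in> E. e \<subseteq> U})"
    and "card U' \<le> card U + b * q"
proof -
  have ws: "length ws = q" "\<forall>w\<in>set ws. length w = b" "distinct (trail (step a q) v ws)"
    "set (trail (step a q) v ws) \<subseteq> E"
    using assms(6) by (auto simp: walks_def)
  then have ne: "\<forall>w\<in>set ws. w \<noteq> []" using assms(2) by fastforce
  let ?N = "filter (\<lambda>e. \<not> e \<subseteq> U) (trail (step a q) v ws)"
  have U': "card U' - card U = card (\<Union>(set ` set ws) - U)"
  proof -
    have "card (U' - U) = card U' - card U"
      by (rule card_Diff_subset) (use assms(4) in \<open>auto simp: U'_def\<close>)
    moreover have "U' - U = \<Union>(set ` set ws) - U" by (auto simp: U'_def)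
    ultimately show ?thesis by simp
  qed
  have "q * card (\<Union>(set ` set ws) - U) \<le> a * length ?N +
     (if tip (step a q) v ws \<in> U then 0 else q * profile a q (length ws) - length ws * a)"
    by (rule new_vertices_bound) (use assms ne in auto)
  then have bound: "q * card (\<Union>(set ` set ws) - U) \<le> a * length ?N"
    using profile_self[OF assms(1)] ws(1) by (simp split: if_splits)
  have "length ?N = card (set ?N)" using ws(3) distinct_card[of ?N] by simp
  also have "\<dots> \<le> card ({e \<in> E. e \<subseteq> U'} - {e \<in> E. e \<subseteq> U})"
  proof (rule card_mono)
    have "\<Union>(set (trail (step a q) v ws)) \<subseteq> U'"
      using set_trail_subset[of ws] ne assms(5) by (auto simp: U'_def)
    then show "set ?N \<subseteq> {e \<in> E. e \<subseteq> U'} - {e \<in> E. e \<subseteq> U}" using ws(4) by auto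
  qed (use assms(3) in simp)
  also have "\<dots> = card {e \<in> E. e \<subseteq> U'} - card {e \<in> E. e \<subseteq> U}"
    by (rule card_Diff_subset) (use assms(3) in \<open>auto simp: U'_def\<close>)
  finally show "q * (card U' - card U) \<le> a * (card {e \<in> E. e \<subseteq> U'} - card {e \<in> E. e \<subseteq> U})"
    unfolding U' using bound by (meson le_trans mult_le_mono2)
  have "card U' \<le> card U + card (set (concat ws))"
    unfolding U'_def set_concat by (rule card_Un_le)
  also have "card (set (concat ws)) \<le> b * q"
  proof -
    have "length (concat ws) = b * q" unfolding ws(1)[symmetric] using ws(2) by (induction ws) auto
    then show ?thesis using card_length[of "concat ws"] by simp
  qed
  finally show "card U' \<le> card U + b * q" by simp
qed

text \<open>Starting from \<open>R0\<close>, which causes the deficit \<open>q * c\<close>, walks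
  are added one at a time. While \<open>U\<close> is small, \<open>\<Phi>\<close> has more members
  than there are walks inside \<open>U\<close>, so one of them leaves \<open>U\<close>; adding it
  does not increase the deficit.\<close>

lemma dense_union_of_walks:
  assumes "q > 0" "b > 0" "finite W" "E \<subseteq> nsets W (Suc b)" "v \<in> W" "card R0 \<le> c" "v \<in> R0" "R0 \<subseteq> W"
    and "\<Phi> \<subseteq> walks (step a q) E b v q" "finite \<Phi>" "\<And>ws. ws \<in> \<Phi> \<Longrightarrow> set (roots (step a q) ws) \<subseteq> R0"
    and "card \<Phi> > (N + c) ^ (b * q)"
  shows "\<exists>U. U \<subseteq> W \<and> N \<le> card U \<and> card U \<le> N + c + b * q \<and> q * card U \<le> a * card {e \<in> E. e \<subseteq> U} + q * c"
proof -
  have finE: "finite E" using assms(3,4) by (meson finite_imp_finite_nsets finite_subset)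
  have "\<exists>U. R0 \<subseteq> U \<and> U \<subseteq> W \<and> k \<le> card U \<and> card U \<le> k + c + b * q \<and>
      q * card U \<le> a * card {e \<in> E. e \<subseteq> U} + q * c" if "k \<le> N" for k
    using that
  proof (induction k)
    case 0
    have "q * card R0 \<le> a * card {e \<in> E. e \<subseteq> R0} + q * c" using assms(6) by (simp add: trans_le_add2)
    then show ?case using assms(6,8) by (intro exI[of _ R0]) auto
  next
    case (Suc k)
    then obtain U where U: "R0 \<subseteq> U" "U \<subseteq> W" "k \<le> card U" "card U \<le> k + c + b * q"
      "q * card U \<le> a * card {e \<in> E. e \<subseteq> U} + q * c" by auto
    have "finite U" using U(2) assms(3) by (rule finite_subset)
    show ?case
    \<comment> \<open>Either \<open>U\<close> has more than \<open>k\<close> vertices and serves for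
      \<open>Suc k\<close> too, or it has exactly \<open>k\<close> and receives another walk. This
      keeps the overshoot within \<open>c + b * q\<close>.\<close>
    proof (cases "card U \<le> N + c \<and> card U = k")
      case False
      then have "Suc k \<le> card U" using U(3) Suc.prems by linarith
      then show ?thesis using U by (intro exI[of _ U]) auto
    next
      case True
      have "\<not> \<Phi> \<subseteq> {ws \<in> walks (step a q) E b v q. \<Union>(set ` set ws) \<subseteq> U}"
      proof
        assume "\<Phi> \<subseteq> {ws \<in> walks (step a q) E b v q. \<Union>(set ` set ws) \<subseteq> U}"
        then have "card \<Phi> \<le> card U ^ (b * q)"
          using card_walks_inside[OF \<open>finite U\<close>] by (meson card_mono order_trans)
        also have "\<dots> \<le> (N + c) ^ (b * q)" using True by (intro power_mono) auto
        finally show False using assms(12) by simp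
      qed
      then obtain ws where ws: "ws \<in> \<Phi>" "\<not> \<Union>(set ` set ws) \<subseteq> U" using assms(9) by blast
      define U' where "U' = U \<union> \<Union>(set ` set ws)"
      have walk: "ws \<in> walks (step a q) E b v q" using ws assms(9) by auto
      have ext: "q * (card U' - card U) \<le> a * (card {e \<in> E. e \<subseteq> U'} - card {e \<in> E. e \<subseteq> U})"
        "card U' \<le> card U + b * q"
        unfolding U'_def
        using extend_by_walk[OF assms(1,2) finE \<open>finite U\<close> _ walk] assms(7) assms(11)[OF ws(1)] U(1) by blast+
      have "\<Union>E \<subseteq> W" using assms(4) by (auto simp: nsets_def)
      then have "U' \<subseteq> W" using walks_verts(1)[OF walk] U(2) assms(2,5) by (simp add: U'_def)
      moreover have "card U < card U'"
        by (rule psubset_card_mono) (use ws(2) \<open>finite U\<close> in \<open>auto simp: U'_def\<close>)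
      moreover have "card {e \<in> E. e \<subseteq> U} \<le> card {e \<in> E. e \<subseteq> U'}"
        by (rule card_mono) (use finE in \<open>auto simp: U'_def\<close>)
      then have "a * card {e \<in> E. e \<subseteq> U} \<le> a * card {e \<in> E. e \<subseteq> U'}" by (rule mult_le_mono2)
      then have "q * card U' \<le> a * card {e \<in> E. e \<subseteq> U'} + q * c"
        using ext(1)[unfolded diff_mult_distrib2] U(5) by linarith
      moreover have "R0 \<subseteq> U'" using U(1) by (auto simp: U'_def)
      ultimately show ?thesis using ext(2) True by (intro exI[of _ U']) auto
    qed
  qed
  then show ?thesis by blast
qed

text \<open>Pigeonhole over the lists of \<open>q * b - a\<close> roots: at least
  \<open>(D - q) ^ q\<close> walks start at a fixed vertex, so by \<open>big\<close> some list is
  shared by more than \<open>(N + Suc (q * b)) ^ (b * q)\<close> of them. Here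
  \<open>Suc (q * b)\<close> bounds the number of roots together with the start vertex.\<close>

lemma dense_sub_of_min_degree:
  assumes "q > 0" "b > 0" "a \<le> q * b" "finite W" "E \<subseteq> nsets W (Suc b)" "W \<noteq> {}"
    and deg: "\<And>v. v \<in> W \<Longrightarrow> D \<le> card {e \<in> E. v \<in> e}"
    and big: "card W ^ (q * b - a) * (N + Suc (q * b)) ^ (b * q) < (D - q) ^ q"
  shows "\<exists>U. U \<subseteq> W \<and> N \<le> card U \<and> card U \<le> N + Suc (q * b) + b * q \<and>
    q * card U \<le> a * card {e \<in> E. e \<subseteq> U} + q * Suc (q * b)"
proof -
  obtain v where v: "v \<in> W" using assms(6) by auto
  have EW: "\<Union>E \<subseteq> W" using assms(5) by (auto simp: nsets_def)
  let ?g = "step a q"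
  let ?F = "walks ?g E b v q"
  let ?c = "q * b - a"
  define K where "K = {ks. set ks \<subseteq> W \<and> length ks = ?c}"
  have finF: "finite ?F" using finite_walks[OF assms(4) EW v assms(2)] .
  have K: "finite K" "card K = card W ^ ?c"
    unfolding K_def using finite_lists_length_eq[OF assms(4)] card_lists_length_eq[OF assms(4)] by auto
  have set_roots: "set (roots g ws) \<subseteq> \<Union>(set ` set ws)" for g and ws :: "'a list list"
    by (induction ws) (auto dest: in_set_dropD)
  have "roots ?g ` ?F \<subseteq> K"
  proof (rule image_subsetI)
    fix ws assume ws: "ws \<in> ?F"
    have "length (roots ?g ws) + a = q * b"
      using length_roots[of ws b a q] step_le[OF assms(1,3)] ws profile_self[OF assms(1)]
      by (auto simp: walks_def)
    then show "roots ?g ws \<in> K"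
      using set_roots[of ?g ws] walks_verts(1)[OF ws EW v assms(2)] by (auto simp: K_def)
  qed
  have "\<exists>y\<in>K. (N + Suc (q * b)) ^ (b * q) < card {ws \<in> ?F. roots ?g ws = y}"
  proof (rule ccontr)
    assume "\<not> ?thesis"
    then have le: "card {ws \<in> ?F. roots ?g ws = y} \<le> (N + Suc (q * b)) ^ (b * q)" if "y \<in> K" for y
      using that by (meson not_le)
    have "?F = (\<Union>y\<in>K. {ws \<in> ?F. roots ?g ws = y})" using \<open>roots ?g ` ?F \<subseteq> K\<close> by auto
    then have "card ?F \<le> (\<Sum>y\<in>K. card {ws \<in> ?F. roots ?g ws = y})"
      using card_UN_le[OF K(1), of "\<lambda>y. {ws \<in> ?F. roots ?g ws = y}"] by argo
    also have "\<dots> \<le> card K * (N + Suc (q * b)) ^ (b * q)"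
      using sum_bounded_above[of K "\<lambda>y. card {ws \<in> ?F. roots ?g ws = y}" "(N + Suc (q * b)) ^ (b * q)"] le by simp
    also have "\<dots> < (D - q) ^ q" using big K(2) by simp
    also have "\<dots> \<le> card ?F" by (rule card_walks_ge[OF assms(4,5,2) v order_refl deg])
    finally show False by simp
  qed
  then obtain y where y: "y \<in> K" "(N + Suc (q * b)) ^ (b * q) < card {ws \<in> ?F. roots ?g ws = y}"
    by blast
  show ?thesis
  proof (rule dense_union_of_walks[of q b W E v "insert v (set y)"])
    have "card (insert v (set y)) \<le> Suc (card (set y))" by (simp add: card_insert_if)
    also have "\<dots> \<le> Suc (q * b)" using y(1) card_length[of y] by (simp add: K_def)
    finally show "card (insert v (set y)) \<le> Suc (q * b)" .
    show "insert v (set y) \<subseteq> W" using y(1) v by (auto simp: K_def)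
  qed (use assms v y finF in auto)
qed

section \<open>Asymptotics and choice of the parameters\<close>

lemma inverse_alpha:
  assumes "s \<noteq> 0"
  shows "1 / alpha r s = real r - 1 - real r / s"
  using assms by (simp add: alpha_def field_simps)

text \<open>Up to constants the two sides are powers of \<open>n\<close> with exponents
  \<open>d\<close> and \<open>\<beta> * q\<close>. For large \<open>n\<close>, subtracting
  \<open>q\<close> costs at most half of the base, and the gap between the exponents absorbs the
  constants.\<close>

lemma eventually_many_walks:
  fixes \<beta> :: real and C q d :: nat
  assumes "r > 0" "\<beta> > 0" "d < \<beta> * q"
  shows "\<forall>\<^sub>F n in sequentially. n ^ d * C < (nat \<lceil>real n powr \<beta> / r\<rceil> - q) ^ q"
proof -
  define \<gamma> where "\<gamma> = \<beta> * q - d"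
  have "\<gamma> > 0" using assms(3) by (simp add: \<gamma>_def)
  then have 1: "\<forall>\<^sub>F n::nat in sequentially. C * (2 * r) ^ q < real n powr \<gamma>" by real_asymp
  have 2: "\<forall>\<^sub>F n::nat in sequentially. 2 * r * q < real n powr \<beta>" using assms(2) by real_asymp
  show ?thesis using 1 2 eventually_gt_at_top[of 0]
  proof eventually_elim
    case (elim n)
    let ?D = "nat \<lceil>real n powr \<beta> / r\<rceil>"
    have "real n powr \<beta> / r \<le> ?D" by linarith
    moreover have "q \<le> real n powr \<beta> / (2 * r)" using elim(2) assms(1) by (simp add: field_simps)
    moreover have "real n powr \<beta> / r = real n powr \<beta> / (2 * r) + real n powr \<beta> / (2 * r)"
      using assms(1) by (simp add: field_simps)
    ultimately have D: "real n powr \<beta> / (2 * r) \<le> real (?D - q)" by linarith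
    have "real (n ^ d * C) * (2 * r) ^ q = real n powr d * (C * (2 * r) ^ q)"
      using elim(3) by (simp add: powr_realpow)
    also have "\<dots> < real n powr d * real n powr \<gamma>"
      using elim(1,3) by (intro mult_strict_left_mono) auto
    also have "\<dots> = (real n powr \<beta>) ^ q"
      using elim(3) by (simp add: \<gamma>_def powr_add[symmetric] powr_power mult.commute)
    also have "\<dots> = (real n powr \<beta> / (2 * r)) ^ q * (2 * r) ^ q"
      using assms(1) by (simp add: power_divide)
    finally have "real (n ^ d * C) < (real n powr \<beta> / (2 * r)) ^ q"
      using assms(1) by simp
    also have "\<dots> \<le> real (?D - q) ^ q" using D assms(1) by (intro power_mono) auto
    finally show ?case by (metis of_nat_less_iff of_nat_power)
  qed
qed

text \<open>A subset of large minimum degree contains a set with at least \<open>M\<close> vertices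
  and small deficit, and the last hypothesis then forces \<open>k\<close> edges inside it.
  Discarding edges and adding arbitrary vertices makes both numbers exact, as a search with a fixed
  number of loops requires.\<close>

lemma eventually_dense_sub:
  fixes r a q M k :: nat and s \<epsilon> :: real
  assumes "r \<ge> 3" "s > real r / (real r - 1)" "q > 0" "a > 0"
    and ratio: "real r / s - \<epsilon> < a / q" "a / q < real r / s"
    and M: "a * k + q * Suc (q * (r - 1)) \<le> q * M"
  shows "\<forall>\<^sub>F n in sequentially. \<forall>H :: 'a hypergraph.
    r_graph r H \<and> card (verts H) = n \<and> avg_degree r H \<ge> real n powr (1 / alpha r s + \<epsilon>) \<longrightarrow>
    (\<exists>U E'. U \<subseteq> verts H \<and> card U = M + Suc (q * (r - 1)) + (r - 1) * q \<and>
       E' \<subseteq> edges H \<and> card E' = k \<and> \<Union>E' \<subseteq> U)"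
proof -
  define b where "b = r - 1"
  define \<beta> where "\<beta> = 1 / alpha r s + \<epsilon>"
  let ?T = "M + Suc (q * b) + b * q"
  have b: "real b = real r - 1" "b > 0" and r: "Suc b = r" using assms(1) by (auto simp: b_def)
  have "real r / (real r - 1) > 0" using assms(1) by simp
  then have s: "s > 0" using assms(2) by linarith
  have "real r < s * (real r - 1)" using assms(1,2) by (simp add: pos_divide_less_eq)
  then have "real r / s < b" unfolding b(1) using s by (simp add: pos_divide_less_eq mult.commute)
  then have "a / q < b" using ratio by linarith
  then have "real a < real (q * b)" using assms(3) by (simp add: field_simps)
  then have ab: "a \<le> q * b" by linarith
  have \<beta>: "\<beta> = b - real r / s + \<epsilon>" using inverse_alpha[of s r] s b(1) by (simp add: \<beta>_def)
  \<comment> \<open>As \<open>\<beta> = b - r / s + \<epsilon>\<close>, the lower bound on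
    \<open>a / q\<close> makes \<open>q * \<beta>\<close>, the exponent of the number of walks,
    larger than \<open>q * b - a\<close>, the exponent of the number of root lists.\<close>
  then have "real b - a / q < \<beta>" using ratio by linarith
  then have "real (q * b - a) < \<beta> * q" "\<beta> > 0"
    using assms(3) ab \<open>a / q < b\<close> by (simp add: field_simps of_nat_diff, linarith)
  then have "\<forall>\<^sub>F n in sequentially.
      n ^ (q * b - a) * (M + Suc (q * b)) ^ (b * q) < (nat \<lceil>real n powr \<beta> / r\<rceil> - q) ^ q"
    using assms(1) by (intro eventually_many_walks) auto
  then show ?thesis using eventually_ge_at_top[of ?T]
  proof eventually_elim
    case (elim n)
    show ?case
    proof (intro allI impI, elim conjE)
      fix H :: "'a hypergraph"
      assume H: "r_graph r H" "card (verts H) = n" "real n powr (1 / alpha r s + \<epsilon>) \<le> avg_degree r H"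
      have fin: "finite (verts H)" and edges: "edges H \<subseteq> nsets (verts H) r"
        using H(1) by (auto simp: r_graph_def)
      have finE: "finite (edges H)" using fin edges by (meson finite_imp_finite_nsets finite_subset)
      have n: "n > 0" using elim(2) by simp
      let ?\<delta> = "real n powr \<beta> / r"
      have "?\<delta> * card (verts H) \<le> card (edges H)"
        using H(2,3) n assms(1) by (simp add: avg_degree_def \<beta>_def field_simps)
      moreover have "verts H \<noteq> {}" using n H(2) by auto
      ultimately obtain W where W: "W \<subseteq> verts H" "W \<noteq> {}"
        "\<And>v. v \<in> W \<Longrightarrow> ?\<delta> \<le> card {e \<in> edges H. e \<subseteq> W \<and> v \<in> e}"
        using ex_min_degree_subset[OF fin _ edges, of ?\<delta>] assms(1) n by auto
      let ?E = "{e \<in> edges H. e \<subseteq> W}"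
      have "\<exists>U. U \<subseteq> W \<and> M \<le> card U \<and> card U \<le> ?T \<and>
        q * card U \<le> a * card {e \<in> ?E. e \<subseteq> U} + q * Suc (q * b)"
      proof (rule dense_sub_of_min_degree[OF assms(3) b(2) ab])
        show "finite W" using W(1) fin by (rule finite_subset)
        show "?E \<subseteq> nsets W (Suc b)" unfolding r using edges by (auto simp: nsets_def)
        show "nat \<lceil>?\<delta>\<rceil> \<le> card {e \<in> ?E. v \<in> e}" if "v \<in> W" for v
        proof -
          have "{e \<in> ?E. v \<in> e} = {e \<in> edges H. e \<subseteq> W \<and> v \<in> e}" by auto
          then show ?thesis using W(3)[OF that] by (simp add: nat_le_iff ceiling_le_iff)
        qed
        have "card W \<le> n" using W(1) fin H(2) card_mono by metis
        then have "card W ^ (q * b - a) \<le> n ^ (q * b - a)" by (rule power_mono) simp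
        then show "card W ^ (q * b - a) * (M + Suc (q * b)) ^ (b * q) < (nat \<lceil>?\<delta>\<rceil> - q) ^ q"
          using elim(1) by (meson le_less_trans mult_le_mono1)
      qed (use W in auto)
      then obtain U where U: "U \<subseteq> W" "M \<le> card U" "card U \<le> ?T"
        "q * card U \<le> a * card {e \<in> ?E. e \<subseteq> U} + q * Suc (q * b)" by blast
      have "q * M \<le> q * card U" using U(2) by simp
      then have "a * k \<le> a * card {e \<in> ?E. e \<subseteq> U}" using M U(4) unfolding b_def by linarith
      then have "k \<le> card {e \<in> ?E. e \<subseteq> U}" using assms(4) by simp
      then obtain E' where E': "E' \<subseteq> {e \<in> ?E. e \<subseteq> U}" "card E' = k"
        by (rule obtain_subset_with_card_n)
      have "U \<subseteq> verts H" using U W by auto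
      then obtain U' where U': "U \<subseteq> U'" "U' \<subseteq> verts H" "card U' = ?T"
        using exists_subset_between[of U ?T "verts H"] U(3) fin elim(2) H(2) by blast
      have "\<Union>E' \<subseteq> U'" "E' \<subseteq> edges H" using E'(1) U'(1) by blast+
      then show "\<exists>U E'. U \<subseteq> verts H \<and> card U = M + Suc (q * (r - 1)) + (r - 1) * q \<and>
       E' \<subseteq> edges H \<and> card E' = k \<and> \<Union>E' \<subseteq> U"
        using E'(2) U'(2,3) unfolding b_def by blast
    qed
  qed
qed

text \<open>The number \<open>k\<close> of edges must be at least \<open>s / r\<close> times the
  total number of vertices, while only about \<open>q * M / a\<close> edges are guaranteed. Since
  \<open>s / r < q / a\<close>, a large \<open>M\<close> leaves room for both, whatever the additive
  constants.\<close>

lemma ex_parameters: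
  fixes s \<epsilon> :: real
  assumes "r \<ge> 3" "s > real r / (real r - 1)" "\<epsilon> > 0"
  obtains a q M k :: nat where "q > 0" "a > 0" "real r / s - \<epsilon> < a / q" "a / q < real r / s"
    "a * k + q * Suc (q * (r - 1)) \<le> q * M"
    "real r * k \<ge> s * real (M + Suc (q * (r - 1)) + (r - 1) * q)"
proof -
  have "real r / (real r - 1) > 0" using assms(1) by simp
  then have s: "s > 0" using assms(2) by linarith
  \<comment> \<open>The maximum with 0 makes the chosen rational positive, hence
    \<open>a > 0\<close>.\<close>
  have "max 0 (real r / s - \<epsilon>) < real r / s" using s assms by simp
  then obtain x where x: "x \<in> \<rat>" "max 0 (real r / s - \<epsilon>) < x" "x < real r / s"
    using Rats_dense_in_real by metis
  then obtain a q :: nat where aq: "q \<noteq> 0" "\<bar>x\<bar> = a / q" using Rats_abs_nat_div_natE by metis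
  then have xaq: "x = a / q" using x by simp
  then have "a > 0" using x(2) by (cases "a = 0") auto
  have sa: "s * a / r < q" using x(3) aq(1) s assms(1) by (simp add: xaq field_simps)
  define d where "d = Suc (q * (r - 1)) + (r - 1) * q"
  define c where "c = Suc (q * (r - 1))"
  \<comment> \<open>Obtained by substituting the bound on \<open>k\<close> into
    \<open>a * k + q * c \<le> q * M\<close> and solving for \<open>M\<close>; the summand
    \<open>a\<close> pays for rounding \<open>k\<close> up.\<close>
  define M where "M = nat \<lceil>(s * a / r * d + a + q * c) / (q - s * a / r)\<rceil>"
  define k where "k = nat \<lceil>s * real (M + d) / r\<rceil>"
  have "(s * a / r * d + a + q * c) / (q - s * a / r) \<le> M" unfolding M_def by linarith
  then have M: "s * a / r * d + a + q * c \<le> M * (q - s * a / r)"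
    using sa by (simp add: pos_divide_le_eq)
  have "s * real (M + d) / r \<ge> 0" using s by simp
  then have k: "s * real (M + d) / r \<le> k" "k \<le> s * real (M + d) / r + 1"
    unfolding k_def by linarith+
  have "real a * k \<le> a * (s * real (M + d) / r + 1)" using k(2) by (rule mult_left_mono) simp
  also have "\<dots> = s * a / r * M + s * a / r * d + a" by (simp add: field_simps add_divide_distrib)
  finally have "real (a * k + q * c) \<le> real (q * M)" using M by (simp add: algebra_simps)
  then have "a * k + q * c \<le> q * M" by linarith
  moreover have "real r * k \<ge> s * real (M + d)" using k(1) assms(1) by (simp add: field_simps)
  ultimately show thesis
    using that[of q a k M] aq x \<open>a > 0\<close> xaq by (simp add: c_def d_def add.assoc)
qed

section \<open>Straight-line programs and loops\<close>

primrec straight :: "program \<Rightarrow> bool" where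
  "straight Skip = True"
| "straight (Const i k) = True"
| "straight (Add i j k) = True"
| "straight (Sub i j k) = True"
| "straight (Load i j) = True"
| "straight (Store i j) = True"
| "straight (Seq p q) = (straight p \<and> straight q)"
| "straight (IfPos i p q) = (straight p \<and> straight q)"
| "straight (WhilePos i p) = False"

text \<open>The value at \<open>WhilePos\<close> is a placeholder: \<open>run\<close> describes
  execution only for straight programs.\<close>

primrec run :: "program \<Rightarrow> state \<Rightarrow> state" where
  "run Skip \<sigma> = \<sigma>"
| "run (Const i k) \<sigma> = ((fst \<sigma>)(i := k), snd \<sigma>)"
| "run (Add i j k) \<sigma> = ((fst \<sigma>)(i := fst \<sigma> j + fst \<sigma> k), snd \<sigma>)"
| "run (Sub i j k) \<sigma> = ((fst \<sigma>)(i := fst \<sigma> j - fst \<sigma> k), snd \<sigma>)"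
| "run (Load i j) \<sigma> = ((fst \<sigma>)(i := snd \<sigma> (fst \<sigma> j)), snd \<sigma>)"
| "run (Store i j) \<sigma> = (fst \<sigma>, (snd \<sigma>)(fst \<sigma> i := fst \<sigma> j))"
| "run (Seq p q) \<sigma> = run q (run p \<sigma>)"
| "run (IfPos i p q) \<sigma> = (if fst \<sigma> i > 0 then run p \<sigma> else run q \<sigma>)"
| "run (WhilePos i p) \<sigma> = \<sigma>"

text \<open>An upper bound on the running time that does not depend on the state; this is why both
  branches of \<open>IfPos\<close> are added.\<close>

primrec cost :: "program \<Rightarrow> nat" where
  "cost Skip = 1"
| "cost (Const i k) = 1"
| "cost (Add i j k) = 1"
| "cost (Sub i j k) = 1"
| "cost (Load i j) = 1"
| "cost (Store i j) = 1"
| "cost (Seq p q) = cost p + cost q"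
| "cost (IfPos i p q) = 1 + cost p + cost q"
| "cost (WhilePos i p) = 1"

lemma exec_run:
  assumes "straight p"
  shows "\<exists>t\<le>cost p. exec p \<sigma> t (run p \<sigma>)"
  using assms
proof (induction p arbitrary: \<sigma>)
  case (Seq p q)
  then obtain t u where "t \<le> cost p" "exec p \<sigma> t (run p \<sigma>)"
    "u \<le> cost q" "exec q (run p \<sigma>) u (run q (run p \<sigma>))"
    by (metis straight.simps(7))
  then show ?case by (intro exI[of _ "t + u"]) (auto intro: exec.Seq)
next
  case (IfPos i p q)
  show ?case
  proof (cases "fst \<sigma> i > 0")
    case True
    obtain t where "t \<le> cost p" "exec p \<sigma> t (run p \<sigma>)" using IfPos.IH(1)[of \<sigma>] IfPos.prems by auto
    then show ?thesis using True by (intro exI[of _ "1 + t"]) (auto intro: exec.IfTrue[of \<sigma> i, simplified])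
  next
    case False
    obtain t where "t \<le> cost q" "exec q \<sigma> t (run q \<sigma>)" using IfPos.IH(2)[of \<sigma>] IfPos.prems by auto
    then show ?thesis using False by (intro exI[of _ "1 + t"]) (auto intro: exec.IfFalse[of \<sigma> i, simplified])
  qed
qed (cases \<sigma>, force simp del: One_nat_def
  intro: exec.Skip exec.Const exec.Add exec.Sub exec.Load exec.Store)+

definition seqs :: "program list \<Rightarrow> program" where
  "seqs ps = foldr Seq ps Skip"

lemma run_seqs [simp]:
  "run (seqs []) \<sigma> = \<sigma>" "run (seqs (p # ps)) \<sigma> = run (seqs ps) (run p \<sigma>)"
  by (simp_all add: seqs_def)

lemma run_seqs_append: "run (seqs (ps @ qs)) \<sigma> = run (seqs qs) (run (seqs ps) \<sigma>)"
  by (induction ps arbitrary: \<sigma>) auto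

lemma straight_seqs [simp]: "straight (seqs ps) \<longleftrightarrow> (\<forall>p\<in>set ps. straight p)"
  by (induction ps) (auto simp: seqs_def)

text \<open>Register conventions: 0 to 6 hold parameters, 7 to 11 are scratch, 12 is the loop test,
  and the loop variables start at 20.\<close>

abbreviation var :: "nat \<Rightarrow> nat" where
  "var j \<equiv> j + 20"

section \<open>Tests and writes\<close>

text \<open>Register 7 accumulates failures: it stays 0 as long as all tests succeed, so tests are
  combined by mere sequencing. Parameters, loop variables and memory survive a test.\<close>

definition tests :: "program \<Rightarrow> ((nat \<Rightarrow> nat) \<Rightarrow> (nat \<Rightarrow> nat) \<Rightarrow> bool) \<Rightarrow> bool" where
  "tests p \<phi> \<longleftrightarrow> straight p \<and> (\<forall>R M. \<exists>R'. run p (R, M) = (R', M) \<and>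
     (\<forall>i. i < 7 \<or> 12 \<le> i \<longrightarrow> R' i = R i) \<and> (R' 7 = 0 \<longleftrightarrow> R 7 = 0 \<and> \<phi> R M))"

text \<open>The last assumption says that \<open>\<psi>\<close> does not look at scratch registers,
  which the first test may have changed.\<close>

lemma tests_Seq:
  assumes "tests p \<phi>" "tests q \<psi>" "\<And>R R' M. (\<And>i. 12 \<le> i \<Longrightarrow> R' i = R i) \<Longrightarrow> \<psi> R' M = \<psi> R M"
  shows "tests (Seq p q) (\<lambda>R M. \<phi> R M \<and> \<psi> R M)"
  unfolding tests_def
proof (intro conjI allI)
  show "straight (Seq p q)" using assms(1,2)[unfolded tests_def, THEN conjunct1] by simp
  fix R M
  obtain R1 where R1: "run p (R, M) = (R1, M)" "\<forall>i. i < 7 \<or> 12 \<le> i \<longrightarrow> R1 i = R i"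
    "R1 7 = 0 \<longleftrightarrow> R 7 = 0 \<and> \<phi> R M"
    using assms(1) unfolding tests_def by (elim conjE allE[of _ R] allE[of _ M] exE)
  obtain R2 where R2: "run q (R1, M) = (R2, M)" "\<forall>i. i < 7 \<or> 12 \<le> i \<longrightarrow> R2 i = R1 i"
    "R2 7 = 0 \<longleftrightarrow> R1 7 = 0 \<and> \<psi> R1 M"
    using assms(2) unfolding tests_def by (elim conjE allE[of _ R1] allE[of _ M] exE)
  have "\<psi> R1 M = \<psi> R M" by (rule assms(3)) (simp add: R1(2))
  then have "run (Seq p q) (R, M) = (R2, M) \<and> (\<forall>i. i < 7 \<or> 12 \<le> i \<longrightarrow> R2 i = R i) \<and>
      (R2 7 = 0 \<longleftrightarrow> R 7 = 0 \<and> \<phi> R M \<and> \<psi> R M)"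
    using R1 R2 by simp
  then show "\<exists>R'. run (Seq p q) (R, M) = (R', M) \<and>
     (\<forall>i. i < 7 \<or> 12 \<le> i \<longrightarrow> R' i = R i) \<and> (R' 7 = 0 \<longleftrightarrow> R 7 = 0 \<and> \<phi> R M \<and> \<psi> R M)"
    by (rule exI[of _ R2])
qed

lemma tests_seqs:
  assumes "\<And>x. x \<in> set xs \<Longrightarrow> tests (f x) (\<phi> x)"
    and "\<And>x R R' M. x \<in> set xs \<Longrightarrow> (\<And>i. 12 \<le> i \<Longrightarrow> R' i = R i) \<Longrightarrow> \<phi> x R' M = \<phi> x R M"
  shows "tests (seqs (map f xs)) (\<lambda>R M. \<forall>x\<in>set xs. \<phi> x R M)"
  using assms
proof (induction xs)
  case Nil
  show ?case unfolding tests_def by simp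
next
  case (Cons x xs)
  have "tests (Seq (f x) (seqs (map f xs))) (\<lambda>R M. \<phi> x R M \<and> (\<forall>x\<in>set xs. \<phi> x R M))"
  proof (rule tests_Seq)
    show "tests (seqs (map f xs)) (\<lambda>R M. \<forall>x\<in>set xs. \<phi> x R M)"
      by (rule Cons.IH) (rule Cons.prems; simp)+
    show "(\<forall>x\<in>set xs. \<phi> x R' M) = (\<forall>x\<in>set xs. \<phi> x R M)" if "\<And>i. 12 \<le> i \<Longrightarrow> R' i = R i" for R R' M
      by (rule ball_cong[OF refl], rule Cons.prems(2)) (simp_all add: that)
    show "tests (f x) (\<phi> x)" by (rule Cons.prems(1)) simp
  qed
  then show ?case unfolding seqs_def by (simp only: list.map foldr.simps o_apply list.set ball_simps)
qed

text \<open>The truncated difference \<open>1 + R x - R y\<close> vanishes exactly when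
  \<open>R x < R y\<close>.\<close>

definition test_less :: "nat \<Rightarrow> nat \<Rightarrow> program" where
  "test_less x y = seqs [Const 8 1, Add 8 8 x, Sub 8 8 y, Add 7 7 8]"

lemma tests_less: "12 \<le> x \<Longrightarrow> 12 \<le> y \<Longrightarrow> tests (test_less x y) (\<lambda>R M. R x < R y)"
  by (auto simp: tests_def test_less_def)

text \<open>The sum of the two truncated differences is 0 exactly in case of equality. Register 9
  starts as a failure and is cleared at the first match.\<close>

definition test_mem :: "nat \<Rightarrow> nat \<Rightarrow> nat \<Rightarrow> program" where
  "test_mem T x l = Seq (seqs [Const 8 l, Add 8 8 x, Load 8 8, Const 9 1])
     (Seq (seqs (map (\<lambda>i. seqs [Sub 10 8 (var i), Sub 11 (var i) 8, Add 10 10 11, IfPos 10 Skip (Const 9 0)])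
       [0..<T])) (Add 7 7 9))"

lemma tests_mem:
  assumes "12 \<le> x"
  shows "tests (test_mem T x l) (\<lambda>R M. \<exists>i<T. M (l + R x) = R (var i))"
  unfolding tests_def
proof (intro conjI allI)
  let ?f = "\<lambda>i. seqs [Sub 10 8 (var i), Sub 11 (var i) 8, Add 10 10 11, IfPos 10 Skip (Const 9 0)]"
  show "straight (test_mem T x l)" by (auto simp: test_mem_def)
  fix R M :: "nat \<Rightarrow> nat"
  define R0 where "R0 = R(8 := M (l + R x), 9 := 1)"
  have R0: "run (seqs [Const 8 l, Add 8 8 x, Load 8 8, Const 9 1]) (R, M) = (R0, M)"
    using assms by (simp add: R0_def fun_upd_twist)
  have loop: "\<exists>R'. run (seqs (map ?f [0..<k])) (R0, M) = (R', M) \<and>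
      (\<forall>i. i < 9 \<or> 12 \<le> i \<longrightarrow> R' i = R0 i) \<and> R' 9 = (if \<exists>i<k. R0 8 = R0 (var i) then 0 else 1)" for k
  proof (induction k)
    case 0
    then show ?case by (simp add: R0_def)
  next
    case (Suc k)
    then obtain R' where R': "run (seqs (map ?f [0..<k])) (R0, M) = (R', M)"
      "\<And>i. i < 9 \<or> 12 \<le> i \<Longrightarrow> R' i = R0 i" "R' 9 = (if \<exists>i<k. R0 8 = R0 (var i) then 0 else 1)"
      by blast
    have "R' 8 = R0 8" "R' (var k) = R0 (var k)" by (auto simp: R'(2))
    then show ?case
      using R' by (cases "R0 8 = R0 (var k)") (auto simp: run_seqs_append less_Suc_eq)
  qed
  obtain R' where R': "run (seqs (map ?f [0..<T])) (R0, M) = (R', M)"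
      "\<And>i. i < 9 \<or> 12 \<le> i \<Longrightarrow> R' i = R0 i" "R' 9 = (if \<exists>i<T. R0 8 = R0 (var i) then 0 else 1)"
    using loop[of T] by blast
  have "run (test_mem T x l) (R, M) = (R'(7 := R' 7 + R' 9), M)"
    unfolding test_mem_def by (simp only: run.simps R0 R'(1) fst_conv snd_conv)
  moreover have "R' 7 = R 7" using R'(2)[of 7] by (simp add: R0_def)
  moreover have "R0 8 = M (l + R x)" "R0 (var i) = R (var i)" for i by (simp_all add: R0_def)
  ultimately show "\<exists>R'. run (test_mem T x l) (R, M) = (R', M) \<and>
     (\<forall>i. i < 7 \<or> 12 \<le> i \<longrightarrow> R' i = R i) \<and> (R' 7 = 0 \<longleftrightarrow> R 7 = 0 \<and> (\<exists>i<T. M (l + R x) = R (var i)))"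
    using R'(2,3) by (intro exI[of _ "R'(7 := R' 7 + R' 9)"]) (auto simp: R0_def)
qed

definition writes :: "program \<Rightarrow> nat \<Rightarrow> ((nat \<Rightarrow> nat) \<Rightarrow> (nat \<Rightarrow> nat) \<Rightarrow> nat) \<Rightarrow> bool" where
  "writes p x v \<longleftrightarrow> straight p \<and> (\<forall>R M. \<exists>R'. run p (R, M) = (R', M(x := v R M)) \<and>
     (\<forall>i. i < 7 \<or> 12 \<le> i \<longrightarrow> R' i = R i))"

lemma writes_const: "writes (seqs [Const 9 c, Const 8 x, Store 8 9]) x (\<lambda>R M. c)"
  by (auto simp: writes_def)

lemma writes_reg: "12 \<le> y \<Longrightarrow> writes (seqs [Const 8 x, Store 8 y]) x (\<lambda>R M. R y)"
  by (auto simp: writes_def)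

lemma writes_load: "12 \<le> y \<Longrightarrow>
    writes (seqs [Const 9 l, Add 9 9 y, Load 9 9, Const 8 x, Store 8 9]) x (\<lambda>R M. M (l + R y))"
  by (auto simp: writes_def)

text \<open>The second assumption makes the values depend only on the loop variables and on memory
  from \<open>L\<close> on. The writes change neither, so each cell receives the value determined by
  the initial state.\<close>

lemma run_writes:
  assumes "\<And>x. x < L \<Longrightarrow> writes (f x) x (v x)"
    and "\<And>x R' M'. x < L \<Longrightarrow> (\<And>i. 12 \<le> i \<Longrightarrow> R' i = R i) \<Longrightarrow> (\<And>y. L \<le> y \<Longrightarrow> M' y = M y) \<Longrightarrow> v x R' M' = w x"
  shows "\<exists>R'. run (seqs (map f [0..<L])) (R, M) = (R', \<lambda>x. if x < L then w x else M x) \<and>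
     (\<forall>i. i < 7 \<or> 12 \<le> i \<longrightarrow> R' i = R i)"
proof -
  have "\<exists>R'. run (seqs (map f [0..<k])) (R, M) = (R', \<lambda>x. if x < k then w x else M x) \<and>
     (\<forall>i. i < 7 \<or> 12 \<le> i \<longrightarrow> R' i = R i)" if "k \<le> L" for k
    using that
  proof (induction k)
    case (Suc k)
    then obtain R' where R': "run (seqs (map f [0..<k])) (R, M) = (R', \<lambda>x. if x < k then w x else M x)"
      "\<And>i. i < 7 \<or> 12 \<le> i \<Longrightarrow> R' i = R i" by auto
    let ?M = "\<lambda>x. if x < k then w x else M x"
    have "k < L" using Suc.prems by simp
    then obtain R'' where R'': "run (f k) (R', ?M) = (R'', ?M(k := v k R' ?M))"
      "\<And>i. i < 7 \<or> 12 \<le> i \<Longrightarrow> R'' i = R' i"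
      using assms(1)[of k] unfolding writes_def by blast
    have "v k R' ?M = w k" using Suc.prems R'(2) by (intro assms(2)) auto
    then have "?M(k := v k R' ?M) = (\<lambda>x. if x < Suc k then w x else M x)" by (auto simp: less_Suc_eq)
    then show ?case using R' R'' by (intro exI[of _ R'']) (simp add: run_seqs_append)
  qed simp
  then show ?thesis by simp
qed

section \<open>Loops over arithmetic progressions\<close>

text \<open>Register 12 holds the truncated difference of bound and loop variable, which is positive
  exactly while the bound is not reached.\<close>

definition For :: "nat \<Rightarrow> nat \<Rightarrow> nat \<Rightarrow> nat \<Rightarrow> program \<Rightarrow> program" where
  "For i a b c p = Seq (Const i 0) (Seq (Add i i a) (Seq (Sub 12 b i)
     (WhilePos 12 (Seq p (Seq (Add i i c) (Sub 12 b i))))))"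

text \<open>\<open>J\<close> is the loop invariant, \<open>Q\<close> a goal that is never lost once
  reached, and \<open>G\<close> marks values of the loop variable for which the body reaches it;
  thus one good value suffices although the loop runs to its end. Each round adds 3 to the time of
  the body, for the test, the increment and the new difference; the 4 are three initial instructions
  and the final test.\<close>

lemma exec_For:
  fixes J :: "state \<Rightarrow> bool" and Q :: "(nat \<Rightarrow> nat) \<Rightarrow> bool"
  assumes regs: "i \<noteq> 12" "i \<notin> {a, b, c}" "12 \<notin> {a, b, c}" and "C > 0"
    and J_upd: "\<And>R M x. J (R, M) \<Longrightarrow> J (R(i := x), M)" "\<And>R M x. J (R, M) \<Longrightarrow> J (R(12 := x), M)"
    and J_const: "\<And>R M. J (R, M) \<Longrightarrow> R a = A \<and> R b = N \<and> R c = C"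
    and body: "\<And>R M k. J (R, M) \<Longrightarrow> R i = A + C * k \<Longrightarrow> A + C * k < N \<Longrightarrow>
      \<exists>t R' M'. exec p (R, M) t (R', M') \<and> t \<le> B \<and> J (R', M') \<and> R' i = R i \<and> (Q M \<longrightarrow> Q M') \<and>
        (G (A + C * k) \<longrightarrow> Q M')"
    and J: "J (R, M)"
  shows "\<exists>t R' M'. exec (For i a b c p) (R, M) t (R', M') \<and> t \<le> N * (B + 3) + 4 \<and> J (R', M') \<and>
    (Q M \<longrightarrow> Q M') \<and> ((\<exists>k. A + C * k < N \<and> G (A + C * k)) \<longrightarrow> Q M')"
proof -
  let ?w = "WhilePos 12 (Seq p (Seq (Add i i c) (Sub 12 b i)))"
  have loop: "\<exists>t R' M'. exec ?w (R, M) t (R', M') \<and> t \<le> (N - (A + C * k)) * (B + 3) + 1 \<and>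
      J (R', M') \<and> (Q M \<longrightarrow> Q M') \<and> ((\<exists>l\<ge>k. A + C * l < N \<and> G (A + C * l)) \<longrightarrow> Q M')"
    if "J (R, M)" "R i = A + C * k" "R 12 = N - (A + C * k)" for R M k
    using that
  proof (induction "N - (A + C * k)" arbitrary: R M k rule: less_induct)
    case less
    show ?case
    proof (cases "A + C * k < N")
      case False
      have "\<not> A + C * l < N" if "k \<le> l" for l
        using False mult_le_mono2[OF that, of C] by linarith
      moreover have "exec ?w (R, M) 1 (R, M)" using False less.prems(3) by (intro exec.WhileFalse) simp
      moreover have "1 \<le> (N - (A + C * k)) * (B + 3) + 1" by simp
      ultimately show ?thesis using less.prems(1) by blast
    next
      case True
      obtain t R1 M1 where b: "exec p (R, M) t (R1, M1)" "t \<le> B" "J (R1, M1)" "R1 i = R i" "Q M \<longrightarrow> Q M1"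
        "G (A + C * k) \<longrightarrow> Q M1"
        using body[OF less.prems(1,2) True] by blast
      define R2 where "R2 = R1(i := R1 i + R1 c)"
      define R3 where "R3 = R2(12 := R2 b - R2 i)"
      have c1: "R1 c = C" using J_const[OF b(3)] by simp
      have J2: "J (R2, M1)" unfolding R2_def by (rule J_upd(1)[OF b(3)])
      have J3: "J (R3, M1)" unfolding R3_def by (rule J_upd(2)[OF J2])
      have i3: "R3 i = A + C * Suc k" using regs c1 b(4) less.prems(2) by (simp add: R2_def R3_def)
      have t3: "R3 12 = N - (A + C * Suc k)"
        using J_const[OF J2] regs i3 by (simp add: R3_def)
      have dec: "N - (A + C * Suc k) < N - (A + C * k)" using True \<open>C > 0\<close> by simp
      obtain u R4 M4 where w: "exec ?w (R3, M1) u (R4, M4)" "u \<le> (N - (A + C * Suc k)) * (B + 3) + 1"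
        "J (R4, M4)" "Q M1 \<longrightarrow> Q M4" "(\<exists>l\<ge>Suc k. A + C * l < N \<and> G (A + C * l)) \<longrightarrow> Q M4"
        using less.hyps[OF dec J3 i3 t3] by blast
      have "exec (Seq p (Seq (Add i i c) (Sub 12 b i))) (R, M) (t + (1 + 1)) (R3, M1)"
        unfolding R3_def R2_def by (intro exec.Seq[OF b(1)] exec.Seq[OF exec.Add] exec.Sub)
      then have "exec ?w (R, M) (1 + (t + (1 + 1)) + u) (R4, M4)"
        using True less.prems(3) by (intro exec.WhileTrue[OF _ _ w(1)]) auto
      moreover have "1 + (t + (1 + 1)) + u \<le> (N - (A + C * k)) * (B + 3) + 1"
      proof -
        have "Suc (N - (A + C * Suc k)) * (B + 3) \<le> (N - (A + C * k)) * (B + 3)"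
          using dec by (intro mult_le_mono1) simp
        then show ?thesis using b(2) w(2) by simp
      qed
      moreover have "Q M4" if "\<exists>l\<ge>k. A + C * l < N \<and> G (A + C * l)"
        using that b(6) w(4,5) by (metis le_eq_less_or_eq Suc_leI)
      ultimately show ?thesis using w(3,4) b(5) by blast
    qed
  qed
  define R1 where "R1 = R(i := 0)"
  define R2 where "R2 = R1(i := R1 i + R1 a)"
  define R3 where "R3 = R2(12 := R2 b - R2 i)"
  have J2: "J (R2, M)" unfolding R2_def R1_def by (intro J_upd(1) J)
  have J3: "J (R3, M)" unfolding R3_def by (rule J_upd(2)[OF J2])
  have i3: "R3 i = A + C * 0" using regs J_const[OF J] by (simp add: R1_def R2_def R3_def)
  have t3: "R3 12 = N - (A + C * 0)" using J_const[OF J2] regs i3 by (simp add: R3_def)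
  obtain u R4 M4 where w: "exec ?w (R3, M) u (R4, M4)" "u \<le> (N - (A + C * 0)) * (B + 3) + 1"
    "J (R4, M4)" "Q M \<longrightarrow> Q M4" "(\<exists>l\<ge>0. A + C * l < N \<and> G (A + C * l)) \<longrightarrow> Q M4"
    using loop[OF J3 i3 t3] by (elim exE conjE) (rule that)
  have init: "exec (Const i 0) (R, M) 1 (R1, M)" "exec (Add i i a) (R1, M) 1 (R2, M)"
    "exec (Sub 12 b i) (R2, M) 1 (R3, M)"
    unfolding R1_def R2_def R3_def by (rule exec.Const exec.Add exec.Sub)+
  have "exec (For i a b c p) (R, M) (1 + (1 + (1 + u))) (R4, M4)"
    unfolding For_def by (rule exec.Seq[OF init(1) exec.Seq[OF init(2) exec.Seq[OF init(3) w(1)]]])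
  moreover have "1 + (1 + (1 + u)) \<le> N * (B + 3) + 4"
  proof -
    have "(N - (A + C * 0)) * (B + 3) \<le> N * (B + 3)" by (intro mult_le_mono1) simp
    then show ?thesis using w(2) by linarith
  qed
  moreover have "(\<exists>k. A + C * k < N \<and> G (A + C * k)) \<longrightarrow> Q M4" using w(5) by simp
  ultimately have "exec (For i a b c p) (R, M) (1 + (1 + (1 + u))) (R4, M4) \<and>
    1 + (1 + (1 + u)) \<le> N * (B + 3) + 4 \<and> J (R4, M4) \<and> (Q M \<longrightarrow> Q M4) \<and>
    ((\<exists>k. A + C * k < N \<and> G (A + C * k)) \<longrightarrow> Q M4)"
    using w(3,4) by (intro conjI)
  then show ?thesis by blast
qed

section \<open>The search program\<close>

text \<open>The first \<open>T\<close> values are vertices, the other \<open>k\<close> are addresses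
  of edge blocks. Strict increase makes the entries of each kind distinct by comparing neighbours
  only.\<close>

definition valid :: "nat \<Rightarrow> nat \<Rightarrow> nat \<Rightarrow> (nat \<Rightarrow> nat) \<Rightarrow> (nat \<Rightarrow> nat) \<Rightarrow> bool" where
  "valid r T k f M \<longleftrightarrow> (\<forall>j<T - 1. f j < f (Suc j)) \<and> (\<forall>j<k - 1. f (T + j) < f (T + Suc j)) \<and>
     (\<forall>j<k. \<forall>l<r. \<exists>i<T. M (l + f (T + j)) = f i)"

definition check :: "nat \<Rightarrow> nat \<Rightarrow> nat \<Rightarrow> program" where
  "check r T k =
     Seq (seqs (map (\<lambda>j. test_less (var j) (var (Suc j))) [0..<T - 1]))
    (Seq (seqs (map (\<lambda>j. test_less (var (T + j)) (var (T + Suc j))) [0..<k - 1]))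
         (seqs (map (\<lambda>x. test_mem T (var (T + fst x)) (snd x)) (List.product [0..<k] [0..<r]))))"

lemma tests_check: "tests (check r T k) (\<lambda>R M. valid r T k (\<lambda>j. R (var j)) M)"
proof -
  have "tests (check r T k) (\<lambda>R M. (\<forall>j\<in>set [0..<T - 1]. R (var j) < R (var (Suc j))) \<and>
     (\<forall>j\<in>set [0..<k - 1]. R (var (T + j)) < R (var (T + Suc j))) \<and>
     (\<forall>x\<in>set (List.product [0..<k] [0..<r]). \<exists>i<T. M (snd x + R (var (T + fst x))) = R (var i)))"
    unfolding check_def by (intro tests_Seq tests_seqs tests_less tests_mem) simp_all
  moreover have "(\<lambda>R M. (\<forall>j\<in>set [0..<T - 1]. R (var j) < R (var (Suc j))) \<and>
     (\<forall>j\<in>set [0..<k - 1]. R (var (T + j)) < R (var (T + Suc j))) \<and>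
     (\<forall>x\<in>set (List.product [0..<k] [0..<r]). \<exists>i<T. M (snd x + R (var (T + fst x))) = R (var i)))
    = (\<lambda>R M. valid r T k (\<lambda>j. R (var j)) M)"
    by (intro ext) (auto simp: valid_def)
  ultimately show ?thesis by simp
qed

abbreviation output_length :: "nat \<Rightarrow> nat \<Rightarrow> nat \<Rightarrow> nat" where
  "output_length r T k \<equiv> 2 + T + r * k"

text \<open>The output list, addressed by cell. From \<open>T + 2\<close> on, quotient and remainder
  modulo \<open>r\<close> give the edge and the place within its block.\<close>

definition entry :: "nat \<Rightarrow> nat \<Rightarrow> nat \<Rightarrow> (nat \<Rightarrow> nat) \<Rightarrow> (nat \<Rightarrow> nat) \<Rightarrow> nat \<Rightarrow> nat" where
  "entry r T k f M x = (if x = 0 then T else if x \<le> T then f (x - 1) else if x = T + 1 then k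
     else M ((x - T - 2) mod r + f (T + (x - T - 2) div r)))"

definition emit :: "nat \<Rightarrow> nat \<Rightarrow> nat \<Rightarrow> nat \<Rightarrow> program" where
  "emit r T k x =
    (if x = 0 then seqs [Const 9 T, Const 8 x, Store 8 9]
     else if x \<le> T then seqs [Const 8 x, Store 8 (var (x - 1))]
     else if x = T + 1 then seqs [Const 9 k, Const 8 x, Store 8 9]
     else seqs [Const 9 ((x - T - 2) mod r), Add 9 9 (var (T + (x - T - 2) div r)), Load 9 9,
       Const 8 x, Store 8 9])"

lemma writes_emit: "writes (emit r T k x) x (\<lambda>R M. entry r T k (\<lambda>j. R (var j)) M x)"
  unfolding emit_def entry_def
  by (simp del: run_seqs straight_seqs add: writes_const writes_reg writes_load)

definition attempt :: "nat \<Rightarrow> nat \<Rightarrow> nat \<Rightarrow> program" where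
  "attempt r T k = Seq (Const 7 0) (Seq (check r T k)
     (IfPos 7 Skip (seqs (map (emit r T k) [0..<output_length r T k]))))"

lemma straight_attempt: "straight (attempt r T k)"
proof -
  have "straight (check r T k)" using tests_check[of r T k, unfolded tests_def, THEN conjunct1] .
  moreover have "straight (emit r T k x)" for x
    using writes_emit[of r T k x, unfolded writes_def, THEN conjunct1] .
  ultimately show ?thesis by (auto simp: attempt_def)
qed

text \<open>All edge pointers lie beyond the output area, so writing the output never destroys a
  block that has yet to be copied.\<close>

lemma run_attempt:
  assumes "r > 0" "\<And>j. j < k \<Longrightarrow> output_length r T k \<le> R (var (T + j))"
  obtains R' where "run (attempt r T k) (R, M) = (R', if valid r T k (\<lambda>j. R (var j)) M
    then (\<lambda>x. if x < output_length r T k then entry r T k (\<lambda>j. R (var j)) M x else M x) else M)"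
    "\<forall>i. i < 7 \<or> 12 \<le> i \<longrightarrow> R' i = R i"
proof -
  define L where "L = output_length r T k"
  define V where "V = valid r T k (\<lambda>j. R (var j)) M"
  obtain R1 where R1: "run (check r T k) (R(7 := 0), M) = (R1, M)"
    "\<forall>i. i < 7 \<or> 12 \<le> i \<longrightarrow> R1 i = (R(7 := 0)) i"
    "R1 7 = 0 \<longleftrightarrow> (R(7 := 0)) 7 = 0 \<and> valid r T k (\<lambda>j. (R(7 := 0)) (var j)) M"
    using tests_check[of r T k] unfolding tests_def by (elim conjE allE[of _ "R(7 := 0)"] allE[of _ M] exE)
  have R1': "R1 i = R i" if "i < 7 \<or> 12 \<le> i" for i using R1(2) that by auto
  have R17: "R1 7 = 0 \<longleftrightarrow> V" using R1(3) by (simp add: V_def)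
  have run: "run (attempt r T k) (R, M) =
    (if V then run (seqs (map (emit r T k) [0..<L])) (R1, M) else (R1, M))"
    using R1(1) R17 unfolding attempt_def L_def[symmetric] by auto
  show thesis
  proof (cases V)
    case False
    then show thesis using run R1' by (intro that[of R1]) (auto simp: V_def)
  next
    case True
    let ?w = "entry r T k (\<lambda>j. R (var j)) M"
    have "\<exists>R'. run (seqs (map (emit r T k) [0..<L])) (R1, M) = (R', \<lambda>x. if x < L then ?w x else M x) \<and>
     (\<forall>i. i < 7 \<or> 12 \<le> i \<longrightarrow> R' i = R1 i)"
    proof (rule run_writes[where v = "\<lambda>x R M. entry r T k (\<lambda>j. R (var j)) M x"])
      fix x :: nat and R' M' :: "nat \<Rightarrow> nat"
      assume x: "x < L" and R': "\<And>i. 12 \<le> i \<Longrightarrow> R' i = R1 i" and M': "\<And>y. L \<le> y \<Longrightarrow> M' y = M y"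
      have var: "R' (var j) = R (var j)" for j using R' R1' by simp
      \<comment> \<open>Below the output length the quotient is the number of a chosen edge, so its
        pointer is covered by the assumption.\<close>
      have "(x - T - 2) div r < k" if "T + 2 \<le> x"
        using x that assms(1) by (intro less_mult_imp_div_less) (auto simp: L_def mult.commute)
      then have "L \<le> R (var (T + (x - T - 2) div r))" if "T + 2 \<le> x"
        using assms(2) that unfolding L_def by blast
      then have "M' ((x - T - 2) mod r + R (var (T + (x - T - 2) div r))) =
          M ((x - T - 2) mod r + R (var (T + (x - T - 2) div r)))" if "T + 2 \<le> x"
        using that by (intro M') (simp add: trans_le_add2)
      then show "entry r T k (\<lambda>j. R' (var j)) M' x = ?w x"
        by (simp add: entry_def var)
    qed (rule writes_emit)
    then obtain R' where R': "run (seqs (map (emit r T k) [0..<L])) (R1, M) = (R', \<lambda>x. if x < L then ?w x else M x)"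
     "\<forall>i. i < 7 \<or> 12 \<le> i \<longrightarrow> R' i = R1 i" by (elim exE conjE)
    show thesis
    proof (rule that[of R'])
      show "\<forall>i. i < 7 \<or> 12 \<le> i \<longrightarrow> R' i = R i" using R'(2) R1' by simp
    qed (use run R'(1) True in \<open>simp add: V_def L_def\<close>)
  qed
qed

section \<open>The nest of loops\<close>

text \<open>\<open>m\<close> counts the loops still to be entered, so outer loops carry smaller
  indices. Registers 4 to 6 hold start, bound and increment for vertices; registers 1 to 3 hold them
  for pointers.\<close>

primrec nest :: "nat \<Rightarrow> nat \<Rightarrow> nat \<Rightarrow> nat \<Rightarrow> program" where
  "nest r T k 0 = attempt r T k"
| "nest r T k (Suc m) = (let j = T + k - Suc m in
     For (var j) (if j < T then 4 else 1) (if j < T then 5 else 2) (if j < T then 6 else 3) (nest r T k m))"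

primrec nest_cost :: "nat \<Rightarrow> nat \<Rightarrow> nat \<Rightarrow> nat" where
  "nest_cost B N 0 = B"
| "nest_cost B N (Suc m) = N * (nest_cost B N m + 3) + 4"

text \<open>The shift by 8 absorbs the additive terms of the recurrence into a factor
  \<open>2 * N\<close> per loop.\<close>

lemma nest_cost_le: "N > 0 \<Longrightarrow> nest_cost B N m + 8 \<le> (B + 8) * (2 * N) ^ m"
proof (induction m)
  case (Suc m)
  have "nest_cost B N (Suc m) + 8 = N * nest_cost B N m + 3 * N + 12" by (simp add: algebra_simps)
  also have "\<dots> \<le> 2 * N * (nest_cost B N m + 8)" using Suc.prems by (simp add: algebra_simps)
  also have "\<dots> \<le> 2 * N * ((B + 8) * (2 * N) ^ m)" using Suc by (intro mult_le_mono2) simp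
  finally show ?case by (simp add: algebra_simps)
qed simp

text \<open>Agreement with the input is demanded only from the edge list on, because the output
  overwrites lower cells.\<close>

definition env :: "nat \<Rightarrow> nat \<Rightarrow> nat \<Rightarrow> (nat \<Rightarrow> nat) \<Rightarrow> (nat \<Rightarrow> nat) \<Rightarrow> (nat \<Rightarrow> nat) \<Rightarrow> bool" where
  "env n len r I R M \<longleftrightarrow> R 1 = n + 2 \<and> R 2 = len \<and> R 3 = r \<and> R 4 = 0 \<and> R 5 = n \<and> R 6 = 1 \<and>
     (\<forall>x\<ge>n + 2. M x = I x)"

text \<open>The edge blocks start at \<open>n + 2\<close>, behind the two counts and the
  \<open>n\<close> vertices, and have length \<open>r\<close> each.\<close>

definition in_range :: "nat \<Rightarrow> nat \<Rightarrow> nat \<Rightarrow> nat \<Rightarrow> nat \<Rightarrow> nat \<Rightarrow> bool" where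
  "in_range n len r T j x \<longleftrightarrow>
     (if j < T then x < n else \<exists>i. x = n + 2 + r * i \<and> x < len)"

text \<open>Induction on the number of remaining loops, with the outer variables fixed by
  \<open>f\<close>. If some valid assignment \<open>g\<close> extends \<open>f\<close>, the
  innermost program meets it and writes an output with property \<open>P\<close>; all other writes
  have this property too, so it persists.\<close>

lemma exec_nest:
  fixes I f :: "nat \<Rightarrow> nat"
  assumes "r > 0" "output_length r T k \<le> n + 2" "n \<le> len"
    and P: "\<And>f. (\<And>j. j < T + k \<Longrightarrow> in_range n len r T j (f j)) \<Longrightarrow> valid r T k f I \<Longrightarrow>
      P (map (entry r T k f I) [0..<output_length r T k])"
    and "m \<le> T + k" "env n len r I R M"
    and "\<forall>j<T + k - m. in_range n len r T j (f j)"
    and "\<forall>j<T + k - m. R (var j) = f j"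
  shows "\<exists>t R' M'. exec (nest r T k m) (R, M) t (R', M') \<and>
    t \<le> nest_cost (cost (attempt r T k)) len m \<and> env n len r I R' M' \<and>
    (\<forall>j<T + k - m. R' (var j) = f j) \<and>
    (P (map M [0..<output_length r T k]) \<longrightarrow> P (map M' [0..<output_length r T k])) \<and>
    ((\<exists>g. (\<forall>j<T + k - m. g j = f j) \<and> (\<forall>j<T + k. in_range n len r T j (g j)) \<and> valid r T k g I)
      \<longrightarrow> P (map M' [0..<output_length r T k]))"
  using assms(5-8)
proof (induction m arbitrary: f R M)
  case 0
  let ?L = "output_length r T k"
  have vars: "R (var j) = f j" "in_range n len r T j (f j)" if "j < T + k" for j
    using 0 that by auto
  have ptr: "n + 2 \<le> f (T + j)" if "j < k" for j
    using vars(2)[of "T + j"] that by (auto simp: in_range_def)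
  have MI: "M (l + f (T + j)) = I (l + f (T + j))" if "j < k" for l j
    using 0(2) ptr[OF that] by (simp add: env_def)
  have ptr': "?L \<le> R (var (T + j))" if "j < k" for j
    using ptr[OF that] vars(1)[of "T + j"] that assms(2) by simp
  obtain R' where R': "run (attempt r T k) (R, M) = (R', if valid r T k (\<lambda>j. R (var j)) M
    then (\<lambda>x. if x < ?L then entry r T k (\<lambda>j. R (var j)) M x else M x) else M)"
    "\<forall>i. i < 7 \<or> 12 \<le> i \<longrightarrow> R' i = R i"
    using run_attempt[of r k T R M, OF assms(1) ptr'] .
  define M' where "M' = (if valid r T k (\<lambda>j. R (var j)) M
    then (\<lambda>x. if x < ?L then entry r T k (\<lambda>j. R (var j)) M x else M x) else M)"
  have valid_cong: "valid r T k (\<lambda>j. R (var j)) M \<longleftrightarrow> valid r T k g I" if g: "\<And>j. j < T + k \<Longrightarrow> g j = f j" for g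
  proof -
    have "R (21 + j) = f (Suc j)" if "Suc j < T + k" for j using vars(1)[OF that] by simp
    then show ?thesis unfolding valid_def by (simp add: vars(1) MI g cong: conj_cong)
  qed
  have entries: "P (map M' [0..<?L])" if "valid r T k f I"
  proof -
    have "M' x = entry r T k f I x" if "x < ?L" for x
    proof -
      have "(x - T - 2) div r < k" if "T + 2 \<le> x"
        using \<open>x < ?L\<close> that assms(1) by (intro less_mult_imp_div_less) (auto simp: mult.commute)
      moreover have "R (var (x - 1)) = f (x - 1)" if "0 < x" "x \<le> T" by (rule vars(1)) (use that in linarith)
      ultimately have "entry r T k (\<lambda>j. R (var j)) M x = entry r T k f I x"
        unfolding entry_def by (intro if_cong refl) (simp_all only: vars(1) MI, simp_all add: vars(1) MI)
      then show ?thesis using \<open>valid r T k f I\<close> valid_cong[of f] that by (simp add: M'_def)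
    qed
    then have "map M' [0..<?L] = map (entry r T k f I) [0..<?L]"
      by (intro map_cong refl) (simp only: set_upt atLeastLessThan_iff)
    then show ?thesis using P[OF vars(2) \<open>valid r T k f I\<close>] by (simp only:)
  qed
  obtain t where t: "t \<le> cost (attempt r T k)" "exec (attempt r T k) (R, M) t (R', M')"
    using exec_run[OF straight_attempt[of r T k], of "(R, M)"] unfolding R'(1) M'_def by blast
  have "env n len r I R' M'"
    using 0(2) R'(2) assms(2) by (auto simp: env_def M'_def)
  moreover have "\<forall>j<T + k - 0. R' (var j) = f j" using R'(2) vars(1) by simp
  \<comment> \<open>A failed check leaves the memory alone and a successful one writes an output
    with \<open>P\<close>, so an earlier success is not lost.\<close>
  moreover have "P (map M [0..<?L]) \<longrightarrow> P (map M' [0..<?L])"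
    using entries valid_cong[of f] by (cases "valid r T k f I") (auto simp: M'_def)
  moreover have "P (map M' [0..<?L])"
    if "\<exists>g. (\<forall>j<T + k - 0. g j = f j) \<and> (\<forall>j<T + k. in_range n len r T j (g j)) \<and> valid r T k g I"
    using that entries valid_cong[of f] valid_cong by auto
  ultimately have "exec (nest r T k 0) (R, M) t (R', M') \<and>
    t \<le> nest_cost (cost (attempt r T k)) len 0 \<and> env n len r I R' M' \<and>
    (\<forall>j<T + k - 0. R' (var j) = f j) \<and>
    (P (map M [0..<?L]) \<longrightarrow> P (map M' [0..<?L])) \<and>
    ((\<exists>g. (\<forall>j<T + k - 0. g j = f j) \<and> (\<forall>j<T + k. in_range n len r T j (g j)) \<and> valid r T k g I)
      \<longrightarrow> P (map M' [0..<?L]))"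
    using t by simp
  then show ?case by (intro exI[of _ t] exI[of _ "R'"] exI[of _ M'])
next
  case (Suc m)
  let ?L = "output_length r T k"
  define d where "d = T + k - Suc m"
  have d: "T + k - m = Suc d" using Suc.prems(1) by (simp add: d_def)
  have dK: "d < T + k" using Suc.prems(1) by (simp add: d_def)
  define a b c :: nat where "a = (if d < T then 4 else 1)" and "b = (if d < T then 5 else 2)"
    and "c = (if d < T then 6 else 3)"
  define A N C where "A = (if d < T then 0 else n + 2)" and "N = (if d < T then n else len)"
    and "C = (if d < T then 1 else r)"
  define J where "J \<sigma> \<longleftrightarrow> env n len r I (fst \<sigma>) (snd \<sigma>) \<and> (\<forall>j<d. fst \<sigma> (var j) = f j)" for \<sigma>
  \<comment> \<open>The values of variable \<open>d\<close> that can be completed to a valid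
    assignment.\<close>
  define G where "G x \<longleftrightarrow> (\<exists>g. (\<forall>j<d. g j = f j) \<and> g d = x \<and>
    (\<forall>j<T + k. in_range n len r T j (g j)) \<and> valid r T k g I)" for x
  let ?B = "nest_cost (cost (attempt r T k)) len m"
  \<comment> \<open>Vertex loops and pointer loops are treated alike, as progressions from
    \<open>A\<close> with difference \<open>C\<close> below \<open>N\<close>.\<close>
  have range: "in_range n len r T d x \<longleftrightarrow> (\<exists>i. x = A + C * i \<and> x < N)" for x
    by (auto simp: in_range_def A_def C_def N_def)
  have "\<exists>t R' M'. exec (For (var d) a b c (nest r T k m)) (R, M) t (R', M') \<and> t \<le> N * (?B + 3) + 4 \<and>
    J (R', M') \<and> (P (map M [0..<?L]) \<longrightarrow> P (map M' [0..<?L])) \<and>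
    ((\<exists>i. A + C * i < N \<and> G (A + C * i)) \<longrightarrow> P (map M' [0..<?L]))"
  proof (rule exec_For[where A = A and J = J and Q = "\<lambda>M. P (map M [0..<?L])"])
    show "var d \<noteq> 12" "var d \<notin> {a, b, c}" "12 \<notin> {a, b, c}" by (auto simp: a_def b_def c_def)
    show "C > 0" using assms(1) by (simp add: C_def)
    show "J (R(var d := x), M)" "J (R(12 := x), M)" if "J (R, M)" for R M x
      using that by (auto simp: J_def env_def)
    show "R a = A \<and> R b = N \<and> R c = C" if "J (R, M)" for R M
      using that by (auto simp: J_def env_def a_def b_def c_def A_def N_def C_def)
    show "J (R, M)" using Suc.prems by (simp add: J_def d_def)
  next
    fix R M i
    assume J: "J (R, M)" and i: "R (var d) = A + C * i" "A + C * i < N"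
    define f' where "f' = f(d := A + C * i)"
    have env: "env n len r I R M" using J by (simp add: J_def)
    have m: "m \<le> T + k" using Suc.prems(1) by simp
    have f': "\<forall>j<T + k - m. in_range n len r T j (f' j)" "\<forall>j<T + k - m. R (var j) = f' j"
      using Suc.prems(3) J i range[of "A + C * i"]
      by (auto simp: d f'_def J_def d_def[symmetric] less_Suc_eq)
    obtain t R' M' where *: "exec (nest r T k m) (R, M) t (R', M')" "t \<le> ?B" "env n len r I R' M'"
      "\<forall>j<T + k - m. R' (var j) = f' j" "P (map M [0..<?L]) \<longrightarrow> P (map M' [0..<?L])"
      "(\<exists>g. (\<forall>j<T + k - m. g j = f' j) \<and> (\<forall>j<T + k. in_range n len r T j (g j)) \<and> valid r T k g I)
        \<longrightarrow> P (map M' [0..<?L])"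
      using Suc.IH[OF m env f'] by (elim exE conjE)
    have "J (R', M')" using *(3,4) by (simp add: J_def d f'_def)
    moreover have "R' (var d) = R (var d)" using *(4) i by (simp add: d f'_def)
    moreover have "P (map M' [0..<?L])" if G: "G (A + C * i)"
    proof -
      obtain g where "\<forall>j<d. g j = f j" "g d = A + C * i" "\<forall>j<T + k. in_range n len r T j (g j)" "valid r T k g I"
        using G unfolding G_def by (elim exE conjE)
      moreover from this have "\<forall>j<T + k - m. g j = f' j" by (auto simp: d f'_def less_Suc_eq)
      ultimately show ?thesis using *(6) by blast
    qed
    ultimately have "exec (nest r T k m) (R, M) t (R', M') \<and> t \<le> ?B \<and> J (R', M') \<and> R' (var d) = R (var d) \<and>
      (P (map M [0..<?L]) \<longrightarrow> P (map M' [0..<?L])) \<and> (G (A + C * i) \<longrightarrow> P (map M' [0..<?L]))"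
      using *(1,2,5) by simp
    then show "\<exists>t R' M'. exec (nest r T k m) (R, M) t (R', M') \<and> t \<le> ?B \<and> J (R', M') \<and> R' (var d) = R (var d) \<and>
      (P (map M [0..<?L]) \<longrightarrow> P (map M' [0..<?L])) \<and> (G (A + C * i) \<longrightarrow> P (map M' [0..<?L]))"
      by (rule exI[of _ M', THEN exI[of _ R'], THEN exI[of _ t]])
  qed
  then obtain t R' M' where *: "exec (For (var d) a b c (nest r T k m)) (R, M) t (R', M')"
    "t \<le> N * (?B + 3) + 4" "J (R', M')" "P (map M [0..<?L]) \<longrightarrow> P (map M' [0..<?L])"
    "(\<exists>i. A + C * i < N \<and> G (A + C * i)) \<longrightarrow> P (map M' [0..<?L])"
    by (elim exE conjE)
  have "nest r T k (Suc m) = For (var d) a b c (nest r T k m)"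
    by (simp add: Let_def d_def a_def b_def c_def)
  moreover have "t \<le> nest_cost (cost (attempt r T k)) len (Suc m)"
  proof -
    have "N * (?B + 3) \<le> len * (?B + 3)" using assms(3) by (intro mult_le_mono1) (simp add: N_def)
    then show ?thesis using *(2) unfolding nest_cost.simps by linarith
  qed
  moreover have "P (map M' [0..<?L])"
    if ex: "\<exists>g. (\<forall>j<d. g j = f j) \<and> (\<forall>j<T + k. in_range n len r T j (g j)) \<and> valid r T k g I"
  proof -
    obtain g where g: "\<forall>j<d. g j = f j" "\<forall>j<T + k. in_range n len r T j (g j)" "valid r T k g I"
      using ex by (elim exE conjE)
    then have "G (g d)" unfolding G_def by (intro exI[of _ g]) simp
    moreover have "in_range n len r T d (g d)" using g(2) dK by blast
    then obtain i where "g d = A + C * i" "g d < N" unfolding range by blast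
    ultimately show ?thesis using *(5) by auto
  qed
  ultimately have "exec (nest r T k (Suc m)) (R, M) t (R', M') \<and>
    t \<le> nest_cost (cost (attempt r T k)) len (Suc m) \<and> env n len r I R' M' \<and>
    (\<forall>j<T + k - Suc m. R' (var j) = f j) \<and>
    (P (map M [0..<?L]) \<longrightarrow> P (map M' [0..<?L])) \<and>
    ((\<exists>g. (\<forall>j<T + k - Suc m. g j = f j) \<and> (\<forall>j<T + k. in_range n len r T j (g j)) \<and> valid r T k g I)
      \<longrightarrow> P (map M' [0..<?L]))"
    using *(1,3,4) unfolding d_def[symmetric] J_def by simp
  then show ?case by (rule exI[of _ M', THEN exI[of _ R'], THEN exI[of _ t]])
qed

text \<open>Register 4 is initially 0: it serves as the address of the vertex count, as the zero for
  copying register 0, and as the start of the vertex loops. Register 0 holds the input length until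
  the output length replaces it.\<close>

definition search :: "nat \<Rightarrow> nat \<Rightarrow> nat \<Rightarrow> program" where
  "search r T k = Seq (seqs [Load 5 4, Const 6 1, Const 1 2, Add 1 1 5, Add 2 0 4, Const 3 r])
     (Seq (nest r T k (T + k)) (Const 0 (output_length r T k)))"

lemma runs_in_search:
  assumes I_def: "I = (\<lambda>x. if x < length xs then xs ! x else 0)"
    and "r > 0" "output_length r T k \<le> n + 2" "n \<le> length xs" "I 0 = n"
    and P: "\<And>f. (\<And>j. j < T + k \<Longrightarrow> in_range n (length xs) r T j (f j)) \<Longrightarrow> valid r T k f I \<Longrightarrow>
      P (map (entry r T k f I) [0..<output_length r T k])"
    and g: "\<And>j. j < T + k \<Longrightarrow> in_range n (length xs) r T j (g j)" "valid r T k g I"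
  shows "\<exists>t ys. runs_in (search r T k) xs t ys \<and>
    t \<le> nest_cost (cost (attempt r T k)) (length xs) (T + k) + 8 \<and> P ys"
proof -
  let ?prologue = "seqs [Load 5 4, Const 6 1, Const 1 2, Add 1 1 5, Add 2 0 4, Const 3 r]"
  let ?L = "output_length r T k"
  define R0 :: "nat \<Rightarrow> nat" where
    "R0 = (\<lambda>_. 0)(0 := length xs, 5 := n, 6 := 1, 1 := n + 2, 2 := length xs, 3 := r)"
  have "cost ?prologue = 7" by (simp add: seqs_def)
  moreover have "run ?prologue (input_state xs) = (R0, I)"
    using assms(5) by (simp add: input_state_def R0_def I_def fun_upd_twist)
  moreover have "straight ?prologue" by simp
  ultimately obtain t1 where t1: "exec ?prologue (input_state xs) t1 (R0, I)" "t1 \<le> 7"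
    using exec_run[of ?prologue "input_state xs"] by auto
  have "env n (length xs) r I R0 I" by (simp add: env_def R0_def)
  \<comment> \<open>With all loops still to come no variable is fixed, so the choice of
    \<open>f\<close> is arbitrary.\<close>
  from exec_nest[where P = P and f = "\<lambda>_. 0", OF assms(2-4) P order_refl this]
  obtain t2 R' M' where t2: "exec (nest r T k (T + k)) (R0, I) t2 (R', M')"
    "t2 \<le> nest_cost (cost (attempt r T k)) (length xs) (T + k)"
    "(\<exists>g. (\<forall>j<T + k - (T + k). g j = 0) \<and> (\<forall>j<T + k. in_range n (length xs) r T j (g j)) \<and> valid r T k g I)
      \<longrightarrow> P (map M' [0..<?L])"
    by (auto simp: I_def)
  have "exec (search r T k) (input_state xs) (t1 + (t2 + 1)) (R'(0 := ?L), M')"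
    unfolding search_def by (rule exec.Seq[OF t1(1) exec.Seq[OF t2(1) exec.Const]])
  then have "runs_in (search r T k) xs (t1 + (t2 + 1)) (map M' [0..<?L])"
    unfolding runs_in_def output_of_def by (intro exI[of _ "(R'(0 := ?L), M')"]) simp
  moreover have "P (map M' [0..<?L])"
    using t2(3) g by auto
  ultimately show ?thesis using t1(2) t2(2) by (intro exI[of _ "t1 + (t2 + 1)"] exI[of _ "map M' [0..<?L]"]) simp
qed

section \<open>Presentations of uniform hypergraphs\<close>

lemma length_concat_uniform: "\<forall>e\<in>set es. length e = r \<Longrightarrow> length (concat es) = r * length es"
  by (induction es) auto

lemma nth_concat_uniform:
  "\<forall>e\<in>set es. length e = r \<Longrightarrow> i < length es \<Longrightarrow> l < r \<Longrightarrow> concat es ! (r * i + l) = es ! i ! l"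
proof (induction es arbitrary: i)
  case (Cons e es)
  then show ?case by (cases i) (auto simp: nth_append)
qed simp

lemma less_chain:
  fixes f :: "nat \<Rightarrow> nat"
  assumes "\<forall>j<N - 1. f j < f (Suc j)" "i < j" "j < N"
  shows "f i < f j"
  using assms(2,3)
proof (induction j)
  case (Suc j)
  then have "f j < f (Suc j)" using assms(1) by auto
  then show ?case using Suc by (cases "i = j") auto
qed simp

text \<open>One presentation \<open>xs\<close> of a hypergraph on \<open>{..<n}\<close>, with
  \<open>I\<close> the initial memory. That each block is distinct follows from its length and the
  uniformity of \<open>H\<close>.\<close>

locale presented =
  fixes r n :: nat and H :: "nat hypergraph" and vs :: "nat list" and es :: "nat list list"
    and xs :: "nat list" and I :: "nat \<Rightarrow> nat"
  assumes r: "r > 0" and H: "r_graph r H" "verts H = {..<n}" and vs: "length vs = n"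
    and es: "\<forall>e\<in>set es. length e = r" "distinct (map set es)" "set (map set es) = edges H"
    and xs: "xs = n # vs @ length es # concat es"
  defines "I \<equiv> \<lambda>x. if x < length xs then xs ! x else 0"
begin

lemma length_xs: "length xs = n + 2 + r * length es"
  using length_concat_uniform[OF es(1)] by (simp add: xs vs)

text \<open>This makes the input length, and with it the time bound, polynomial in
  \<open>n\<close>.\<close>

lemma length_es: "length es \<le> n ^ r"
proof -
  have "length es = card (edges H)" using distinct_card[OF es(2)] es(3) by simp
  also have "\<dots> \<le> card (nsets {..<n} r)"
    using H by (intro card_mono finite_imp_finite_nsets) (auto simp: r_graph_def)
  also have "\<dots> \<le> n ^ r"
  proof (cases "r \<le> n")
    case True
    then show ?thesis by (simp add: card_nsets binomial_le_pow)
  qed (simp add: card_nsets binomial_eq_0)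
  finally show ?thesis .
qed

lemma I_0: "I 0 = n"
  by (simp add: I_def xs)

lemma I_block:
  assumes "i < length es" "l < r"
  shows "I (l + (n + 2 + r * i)) = es ! i ! l"
proof -
  have "r * i + l < r * length es"
    using assms by (metis add.commute add_less_cancel_left less_le_trans mult_Suc_right mult_le_mono2 Suc_leI)
  then have "l + (n + 2 + r * i) < length xs" by (simp add: length_xs)
  moreover have "xs ! (l + (n + 2 + r * i)) = concat es ! (r * i + l)"
    by (simp add: xs vs nth_append add.commute add.left_commute)
  ultimately show ?thesis using nth_concat_uniform[OF es(1) assms] by (simp add: I_def)
qed

lemma block:
  assumes "i < length es"
  shows "set (es ! i) \<in> edges H" "card (set (es ! i)) = r" "distinct (es ! i)" "length (es ! i) = r"
proof -
  show "set (es ! i) \<in> edges H" unfolding es(3)[symmetric] using assms by auto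
  then show "card (set (es ! i)) = r" using H(1) by (auto simp: r_graph_def nsets_def)
  moreover show "length (es ! i) = r" using es(1) assms by simp
  ultimately show "distinct (es ! i)" by (simp add: card_distinct)
qed

text \<open>Soundness of the search. Increasing pointers select different blocks, which are
  different edges since \<open>xs\<close> lists each edge once; validity puts them inside the chosen
  vertices; and the density is fixed by \<open>T\<close> and \<open>k\<close> alone.\<close>

lemma output_presents:
  assumes "T > 0" "s * T \<le> real r * k"
    and range: "\<And>j. j < T + k \<Longrightarrow> in_range n (length xs) r T j (f j)" and valid: "valid r T k f I"
  shows "\<exists>F. presents (map (entry r T k f I) [0..<output_length r T k]) F \<and> small_dense_sub r s T H F"
proof -
  \<comment> \<open>The loop bound is the input length \<open>n + 2 + r * length es\<close>, so a
    pointer below it points to an actual block.\<close>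
  have "\<exists>i<length es. f (T + j) = n + 2 + r * i" if "j < k" for j
    using range[of "T + j"] that r by (auto simp: in_range_def length_xs)
  then obtain b where b: "\<And>j. j < k \<Longrightarrow> b j < length es" "\<And>j. j < k \<Longrightarrow> f (T + j) = n + 2 + r * b j"
    by metis
  define us where "us = map f [0..<T]"
  define bs where "bs = map (\<lambda>j. es ! b j) [0..<k]"
  define F where "F = (set us, set (map set bs))"
  have bs: "\<forall>e\<in>set bs. length e = r" using b(1) block by (auto simp: bs_def)
  have f_less: "f i < f j" if "i < j" "j < T" for i j
    using valid that by (intro less_chain[of T f]) (simp_all add: valid_def)
  have b_less: "b i < b j" if "i < j" "j < k" for i j
  proof -
    have "f (T + i) < f (T + j)"
      using valid that by (intro less_chain[of k "\<lambda>j. f (T + j)"]) (simp_all add: valid_def)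
    then show ?thesis using b(2)[of i] b(2)[of j] that by simp
  qed
  have us: "distinct us" "length us = T"
  proof -
    have "f i \<noteq> f j" if "i < T" "j < T" "i \<noteq> j" for i j
      using f_less[of i j] f_less[of j i] that by (cases i j rule: linorder_cases) auto
    then show "distinct us" unfolding distinct_conv_nth us_def by simp
  qed (simp add: us_def)
  have dist: "distinct (map set bs)"
  proof -
    have "set (es ! b i) \<noteq> set (es ! b j)" if "i < k" "j < k" "i \<noteq> j" for i j
    proof -
      have "b i \<noteq> b j" using b_less[of i j] b_less[of j i] that by (cases i j rule: linorder_cases) auto
      then show ?thesis
        using nth_eq_iff_index_eq[OF es(2), of "b i" "b j"] b(1)[OF that(1)] b(1)[OF that(2)] by simp
    qed
    then show ?thesis unfolding distinct_conv_nth bs_def by simp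
  qed
  have "set (es ! b j) \<subseteq> set us" if j: "j < k" for j
  proof
    fix x assume "x \<in> set (es ! b j)"
    then obtain l where l: "l < r" "x = es ! b j ! l"
      using block(4)[OF b(1)[OF j]] by (metis in_set_conv_nth)
    then obtain i where "i < T" "I (l + f (T + j)) = f i" using valid j unfolding valid_def by blast
    then have "x = f i" using I_block[OF b(1)[OF j] l(1)] b(2)[OF j] l(2) by simp
    then show "x \<in> set us" using \<open>i < T\<close> by (simp add: us_def)
  qed
  then have "set (es ! b j) \<in> nsets (set us) r \<inter> edges H" if "j < k" for j
    using block(1,2)[OF b(1)[OF that]] that unfolding nsets_def by blast
  then have sub: "set (map set bs) \<subseteq> nsets (set us) r \<inter> edges H"
    unfolding bs_def by auto
  have "map (entry r T k f I) [0..<output_length r T k] = T # us @ k # concat bs"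
  proof (rule nth_equalityI)
    have len: "length (concat bs) = r * k" using length_concat_uniform[OF bs] by (simp add: bs_def)
    then show "length (map (entry r T k f I) [0..<output_length r T k]) = length (T # us @ k # concat bs)"
      by (simp add: us)
    fix x assume x: "x < length (map (entry r T k f I) [0..<output_length r T k])"
    then have eq: "map (entry r T k f I) [0..<output_length r T k] ! x = entry r T k f I x"
      by (simp only: length_map length_upt nth_map nth_upt) simp
    consider "x = 0" | "0 < x" "x \<le> T" | "x = T + 1" | "T + 2 \<le> x" by linarith
    then have "entry r T k f I x = (T # us @ k # concat bs) ! x"
    proof cases
      case 4
      define y where "y = x - T - 2"
      have y: "y < r * k" "x = Suc (T + Suc y)" using x 4 by (auto simp: y_def)
      define j l where "j = y div r" and "l = y mod r"
      have jl: "j < k" "l < r" "y = r * j + l"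
        using y(1) r by (auto simp: j_def l_def less_mult_imp_div_less mult.commute)
      have "entry r T k f I x = I (l + f (T + j))" using 4 by (simp add: entry_def y_def j_def l_def)
      also have "\<dots> = es ! b j ! l" using I_block[OF b(1) jl(2)] b(2) jl(1) by simp
      also have "\<dots> = concat bs ! y"
        using nth_concat_uniform[OF bs, of j l] jl by (simp add: bs_def)
      finally show ?thesis by (simp add: y(2) nth_append us)
    qed (auto simp: entry_def nth_append us(2) us_def)
    then show "map (entry r T k f I) [0..<output_length r T k] ! x = (T # us @ k # concat bs) ! x"
      unfolding eq .
  qed
  moreover have "presents (T # us @ k # concat bs) F"
    unfolding presents_def
    by (rule exI[of _ us], rule exI[of _ bs])
      (use us dist block b(1) in \<open>auto simp: F_def bs_def\<close>)
  moreover have "small_dense_sub r s T H F"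
  proof -
    have "card (verts F) = T" "card (edges F) = k"
      using distinct_card[OF us(1)] us(2) distinct_card[OF dist] by (simp_all add: F_def bs_def)
    moreover have "verts F \<subseteq> verts H"
      using range H(2) by (auto simp: F_def us_def in_range_def)
    moreover have "r_graph r F" "edges F \<subseteq> edges H" using sub by (auto simp: F_def r_graph_def)
    moreover have "verts F \<noteq> {}" using us(2) assms(1) by (auto simp: F_def)
    ultimately show ?thesis
      using assms(1,2) by (simp add: small_dense_sub_def subhypergraph_def avg_degree_def pos_le_divide_eq)
  qed
  ultimately show ?thesis by metis
qed

text \<open>Completeness of the search: list \<open>U\<close> in increasing order, followed by the
  addresses of the blocks of \<open>E'\<close>, also in increasing order.\<close>

lemma ex_valid:
  assumes "U \<subseteq> verts H" "card U = T" "E' \<subseteq> edges H" "card E' = k" "\<Union>E' \<subseteq> U"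
  shows "\<exists>g. (\<forall>j<T + k. in_range n (length xs) r T j (g j)) \<and> valid r T k g I"
proof -
  have "finite U" using assms(1) H(2) finite_subset by auto
  define us where "us = sorted_list_of_set U"
  have us: "sorted_wrt (<) us" "set us = U" "length us = T"
    using \<open>finite U\<close> assms(2) by (auto simp: us_def)
  define B where "B = {i. i < length es \<and> set (es ! i) \<in> E'}"
  have "inj_on (\<lambda>i. set (es ! i)) B"
    using es(2) by (auto simp: B_def inj_on_def distinct_conv_nth)
  moreover have "(\<lambda>i. set (es ! i)) ` B = E'"
  proof
    show "E' \<subseteq> (\<lambda>i. set (es ! i)) ` B"
    proof
      fix e assume e: "e \<in> E'"
      then have "e \<in> set (map set es)" using assms(3) es(3) by auto
      then obtain i where "i < length es" "e = set (es ! i)" by (auto simp: in_set_conv_nth)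
      then show "e \<in> (\<lambda>i. set (es ! i)) ` B" using e by (auto simp: B_def)
    qed
  qed (auto simp: B_def)
  ultimately have "card B = k" using card_image[of "\<lambda>i. set (es ! i)" B] assms(4) by simp
  have "finite B" by (simp add: B_def)
  define bs where "bs = sorted_list_of_set B"
  have bs: "sorted_wrt (<) bs" "set bs = B" "length bs = k"
    using \<open>finite B\<close> \<open>card B = k\<close> by (auto simp: bs_def)
  define g where "g j = (if j < T then us ! j else n + 2 + r * (bs ! (j - T)))" for j
  have bsB: "bs ! j \<in> B" if "j < k" for j using bs that nth_mem by metis
  have "in_range n (length xs) r T j (g j)" if "j < T + k" for j
  proof (cases "j < T")
    case True
    then have "us ! j \<in> verts H" using us assms(1) nth_mem by blast
    then show ?thesis using True H(2) by (simp add: in_range_def g_def)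
  next
    case False
    then have "bs ! (j - T) < length es" using bsB[of "j - T"] that by (auto simp: B_def)
    then show ?thesis using False r by (auto simp: in_range_def g_def length_xs)
  qed
  moreover have "valid r T k g I"
    unfolding valid_def
  proof (intro conjI allI impI)
    show "g j < g (Suc j)" if "j < T - 1" for j
    proof -
      have "Suc j < T" using that by simp
      then show ?thesis using us(3) sorted_wrt_nth_less[OF us(1), of j "Suc j"] by (simp add: g_def)
    qed
    show "g (T + j) < g (T + Suc j)" if "j < k - 1" for j
      using that bs(3) r sorted_wrt_nth_less[OF bs(1), of j "Suc j"] by (simp add: g_def)
    fix j l assume jl: "j < k" "l < r"
    have j: "bs ! j < length es" "set (es ! (bs ! j)) \<subseteq> U" using bsB[OF jl(1)] assms(5) by (auto simp: B_def)
    have "I (l + g (T + j)) = es ! (bs ! j) ! l" using I_block[OF j(1) jl(2)] by (simp add: g_def)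
    also have "\<dots> \<in> set us" using j block(4)[OF j(1)] jl(2) us(2) by auto
    finally obtain i where "i < T" "I (l + g (T + j)) = us ! i" using us(3) by (auto simp: in_set_conv_nth)
    then show "\<exists>i<T. I (l + g (T + j)) = g i" by (intro exI[of _ i]) (simp add: g_def)
  qed
  ultimately show ?thesis by blast
qed

text \<open>Completeness supplies an assignment that the loops reach, and soundness makes whatever
  is finally in the output area correct. The lower bounds on \<open>n\<close> place the output below
  the edge list and absorb the constants of the running time.\<close>

lemma search_finds:
  assumes "T > 0" "s * T \<le> real r * k" "output_length r T k \<le> n + 2"
    and "2 * r + 6 \<le> n" "cost (attempt r T k) + 8 \<le> n"
    and "U \<subseteq> verts H" "card U = T" "E' \<subseteq> edges H" "card E' = k" "\<Union>E' \<subseteq> U"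
  shows "\<exists>t ys F. runs_in (search r T k) xs t ys \<and> t \<le> n ^ (1 + (r + 1) * (T + k)) \<and>
    presents ys F \<and> small_dense_sub r s T H F"
proof -
  let ?B = "cost (attempt r T k)"
  obtain g where g: "\<forall>j<T + k. in_range n (length xs) r T j (g j)" "valid r T k g I"
    using ex_valid[OF assms(6-10)] by blast
  have len: "n \<le> length xs" "length xs > 0" by (simp_all add: length_xs)
  have "\<exists>t ys. runs_in (search r T k) xs t ys \<and> t \<le> nest_cost ?B (length xs) (T + k) + 8 \<and>
    (\<exists>F. presents ys F \<and> small_dense_sub r s T H F)"
    by (rule runs_in_search[where P = "\<lambda>ys. \<exists>F. presents ys F \<and> small_dense_sub r s T H F",
        OF meta_eq_to_obj_eq[OF I_def] r assms(3) len(1) I_0 output_presents[OF assms(1,2)]])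
      (use g in blast)+
  moreover have "nest_cost ?B (length xs) (T + k) + 8 \<le> n ^ (1 + (r + 1) * (T + k))"
  proof -
    have n: "1 \<le> n" "n \<le> n ^ r" using assms(4) r by (auto simp: self_le_power)
    \<comment> \<open>One loop costs a factor \<open>2 * length xs\<close>, which is at most
      \<open>n ^ (r + 1)\<close>; the cost of the innermost program adds one more factor
      \<open>n\<close>.\<close>
    have "2 * length xs \<le> 2 * n + 4 + 2 * r * n ^ r" using length_es length_xs by simp
    also have "\<dots> \<le> 6 * n ^ r + 2 * r * n ^ r" using n by simp
    also have "\<dots> = (2 * r + 6) * n ^ r" by (simp add: algebra_simps)
    also have "\<dots> \<le> n * n ^ r" using assms(4) by (rule mult_le_mono1)
    finally have "(2 * length xs) ^ (T + k) \<le> (n ^ (r + 1)) ^ (T + k)" by (intro power_mono) simp_all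
    then have "(?B + 8) * (2 * length xs) ^ (T + k) \<le> n * (n ^ (r + 1)) ^ (T + k)"
      using assms(5) by (intro mult_le_mono)
    also have "\<dots> = n ^ (1 + (r + 1) * (T + k))" by (simp only: power_mult power_add power_one_right)
    finally show ?thesis using nest_cost_le[OF len(2), of ?B "T + k"] by linarith
  qed
  ultimately show ?thesis by (meson order_trans)
qed

end

lemma presented_exists:
  assumes "presents xs H" "r_graph r H" "verts H = {..<n}" "r > 0"
  obtains vs es where "presented r n H vs es xs"
proof -
  obtain vs es where *: "distinct vs" "set vs = verts H" "\<forall>e\<in>set es. distinct e" "distinct (map set es)"
    "set (map set es) = edges H" "xs = length vs # vs @ length es # concat es"
    using assms(1) unfolding presents_def by blast
  have "length vs = n" using distinct_card[OF *(1)] *(2) assms(3) by simp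
  moreover have "length e = r" if "e \<in> set es" for e
  proof -
    have "set e \<in> edges H" using that *(5) by auto
    then have "card (set e) = r" using assms(2) by (auto simp: r_graph_def nsets_def)
    then show ?thesis using *(3) that distinct_card by metis
  qed
  ultimately show thesis using * assms by (intro that[of vs es]) (unfold_locales, auto)
qed

theorem theorem4:
  fixes r :: nat and s \<epsilon> :: real
  assumes "r \<ge> 3" and "s > real r / (real r - 1)" and "\<epsilon> > 0"
  shows "\<exists>T :: nat.
    (\<forall>\<^sub>F n in sequentially. \<forall>H :: 'a hypergraph.
       r_graph r H \<and> card (verts H) = n \<and>
       avg_degree r H \<ge> real n powr (1 / alpha r s + \<epsilon>) \<longrightarrow>
       (\<exists>F. small_dense_sub r s T H F)) \<and>
    (\<exists>(p :: program) (c :: nat).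
       \<forall>\<^sub>F n in sequentially. \<forall>(H :: nat hypergraph) xs.
         r_graph r H \<and> verts H = {..<n} \<and>
         avg_degree r H \<ge> real n powr (1 / alpha r s + \<epsilon>) \<and> presents xs H \<longrightarrow>
         (\<exists>t ys F. runs_in p xs t ys \<and> t \<le> n ^ c \<and>
                   presents ys F \<and> small_dense_sub r s T H F))"
proof -
  obtain a q M k :: nat where par: "q > 0" "a > 0" "real r / s - \<epsilon> < a / q" "a / q < real r / s"
    "a * k + q * Suc (q * (r - 1)) \<le> q * M"
    and k: "s * real (M + Suc (q * (r - 1)) + (r - 1) * q) \<le> real r * k"
    by (rule ex_parameters[OF assms])
  define T where "T = M + Suc (q * (r - 1)) + (r - 1) * q"
  have T: "T > 0" "s * real T \<le> real r * k" using k by (simp_all add: T_def)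
  \<comment> \<open>The density result is needed twice: for vertices of arbitrary type and for the
    natural numbers on which programs operate. The same \<open>T\<close> and \<open>k\<close> serve
    both.\<close>
  note dense = eventually_dense_sub[where 'a = 'a, OF assms(1,2) par, folded T_def]
    and dense_nat = eventually_dense_sub[where 'a = nat, OF assms(1,2) par, folded T_def]
  have "\<forall>\<^sub>F n in sequentially. \<forall>H :: 'a hypergraph.
       r_graph r H \<and> card (verts H) = n \<and>
       avg_degree r H \<ge> real n powr (1 / alpha r s + \<epsilon>) \<longrightarrow>
       (\<exists>F. small_dense_sub r s T H F)"
    using dense
  proof eventually_elim
    case (elim n)
    show ?case
    proof (intro allI impI)
      fix H :: "'a hypergraph"
      assume H: "r_graph r H \<and> card (verts H) = n \<and> avg_degree r H \<ge> real n powr (1 / alpha r s + \<epsilon>)"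
      then obtain U E' where UE: "U \<subseteq> verts H" "card U = T" "E' \<subseteq> edges H" "card E' = k" "\<Union>E' \<subseteq> U"
        using elim by blast
      have "finite U" using UE(1) H by (auto simp: r_graph_def intro: finite_subset)
      \<comment> \<open>Exactly \<open>T\<close> vertices and \<open>k\<close> edges have average
        degree \<open>r * k / T\<close>, which is at least \<open>s\<close> by the choice of
        \<open>k\<close>.\<close>
      then have "small_dense_sub r s T H (U, E')"
        using UE H T by (auto simp: small_dense_sub_def r_graph_def subhypergraph_def avg_degree_def
          pos_le_divide_eq nsets_def)
      then show "\<exists>F. small_dense_sub r s T H F" by blast
    qed
  qed
  moreover have "\<forall>\<^sub>F n in sequentially. \<forall>(H :: nat hypergraph) xs.
         r_graph r H \<and> verts H = {..<n} \<and>
         avg_degree r H \<ge> real n powr (1 / alpha r s + \<epsilon>) \<and> presents xs H \<longrightarrow>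
         (\<exists>t ys F. runs_in (search r T k) xs t ys \<and> t \<le> n ^ (1 + (r + 1) * (T + k)) \<and>
                   presents ys F \<and> small_dense_sub r s T H F)"
    using dense_nat eventually_ge_at_top[of "output_length r T k"] eventually_ge_at_top[of "2 * r + 6"]
      eventually_ge_at_top[of "cost (attempt r T k) + 8"]
  proof eventually_elim
    case (elim n)
    show ?case
    proof (intro allI impI, elim conjE)
      fix H :: "nat hypergraph" and xs
      assume H: "r_graph r H" "verts H = {..<n}" "avg_degree r H \<ge> real n powr (1 / alpha r s + \<epsilon>)"
        and xs: "presents xs H"
      have "card (verts H) = n" using H(2) by simp
      obtain U E' where UE: "U \<subseteq> verts H" "card U = T" "E' \<subseteq> edges H" "card E' = k" "\<Union>E' \<subseteq> U"
        using elim(1) H(1,3) \<open>card (verts H) = n\<close> by blast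
      obtain vs es where "presented r n H vs es xs"
        using presented_exists[OF xs H(1,2)] assms(1) by auto
      then show "\<exists>t ys F. runs_in (search r T k) xs t ys \<and> t \<le> n ^ (1 + (r + 1) * (T + k)) \<and>
                   presents ys F \<and> small_dense_sub r s T H F"
        by (rule presented.search_finds[OF _ T _ elim(3,4) UE]) (use elim(2) in simp)
    qed
  qed
  ultimately show ?thesis by (intro exI[of _ T]) blast
qed

end
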